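(* Let $-\infty\le a<b\le+\infty$ and let $\varphi:\,]a,b[\,\to\mathbb{R}$ be a smooth function such that $\varphi$ is monotone and $\ddot{\varphi}\ge 0$ on $]a,b[$. Then there is no properly embedded $[\varphi,\vec{e}_3]$-minimal surface $\Sigma$ in $\mathbb{R}^2\times\,]a,b[$ with all of the following properties: (1) there is a constant $C>0$ such that $|\dot{\varphi}(\langle p,\vec{e}_3\rangle)|\le C|p|$ as $p\to\infty$ on $\Sigma$; (2) there is a constant $\epsilon>0$ such that the Gauss map $N$ of $\Sigma$ satisfies $\langle N,\vec{e}_3\rangle\ge\epsilon$ on $\Sigma$; (3) either $\inf_\Sigma\dot{\varphi}^2>0$ or $\inf_\Sigma\ddot{\varphi}>0$.
   Context: $\langle\cdot,\cdot\rangle$ is the Euclidean metric of $\mathbb{R}^3$, $|p|$ is the Euclidean distance from $p$ to the origin, and $\vec{e}_3=(0,0,1)$. A dot denotes the derivative of $\varphi$ with respect to its real variable (the third coordinate); at a point $p$ of a surface, $\varphi$ and its derivatives are evaluated at $\langle p,\vec{e}_3\rangle$, and infima over $\Sigma$ are understood in this sense. An inequality "as $p\to\infty$ on $\Sigma$" means that it holds for all $p\in\Sigma$ with $|p|$ sufficiently large. Surfaces are smooth, nonempty, without boundary, and oriented by a unit normal $N:\Sigma\to\mathbb{S}^2$ (the Gauss map). A surface $\Sigma$ in $\mathbb{R}^2\times\,]a,b[\,\subseteq\mathbb{R}^3$ is $[\varphi,\vec{e}_3]$-minimal if it is a critical point of the weighted area functional $\int_\Sigma e^{\varphi}\,d\Sigma$,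 where $\varphi$ on $\Sigma$ means $p\mapsto\varphi(\langle p,\vec{e}_3\rangle)$ and $d\Sigma$ is the area element induced by the Euclidean metric; equivalently, its mean curvature vector $\mathbf{H}$ (the trace of the vector-valued second fundamental form) satisfies $\mathbf{H}=\dot{\varphi}\,\vec{e}_3^{\,\perp}$, where $\perp$ is the projection onto the normal bundle.
   Formalization: "Properly embedded" is taken as properly embedded in ℝ³ (Σ closed in ℝ³ and contained in ℝ²×]a,b[); with properness only in the slab the claim fails, e.g. φ(t)=t on ]0,1[ and the bowl translator with tip at height 1/2 cut off at height 1. *)

theory Defs
  imports "HOL-Analysis.Analysis"
begin

section \<open>Smooth maps\<close>

(* Intended for open S: a map is C^n there iff it is differentiable and all its
   directional derivatives are C^(n-1). *)
primrec Cn_on :: "nat \<Rightarrow> 'a::euclidean_space set \<Rightarrow> ('a \<Rightarrow> 'b::real_normed_vector) \<Rightarrow> bool" where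
  "Cn_on 0 S f \<longleftrightarrow> continuous_on S f"
| "Cn_on (Suc n) S f \<longleftrightarrow>
     (\<forall>x\<in>S. f differentiable (at x)) \<and>
     (\<forall>v. Cn_on n S (\<lambda>x. frechet_derivative f (at x) v))"

definition smooth_on :: "'a::euclidean_space set \<Rightarrow> ('a \<Rightarrow> 'b::real_normed_vector) \<Rightarrow> bool" where
  "smooth_on S f \<longleftrightarrow> (\<forall>n. Cn_on n S f)"

definition partial :: "2 \<Rightarrow> (real^2 \<Rightarrow> 'b::real_normed_vector) \<Rightarrow> real^2 \<Rightarrow> 'b" where
  "partial i F w = frechet_derivative F (at w) (axis i 1)"


section \<open>Oriented embedded surfaces in Euclidean 3-space\<close>

abbreviation e3 :: "real^3" where
  "e3 \<equiv> axis 3 1"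

definition local_parametrization ::
  "(real^3) set \<Rightarrow> (real^2) set \<Rightarrow> (real^2 \<Rightarrow> real^3) \<Rightarrow> bool" where
  "local_parametrization S U F \<longleftrightarrow>
     open U \<and> smooth_on U F \<and>
     (\<forall>w\<in>U. inj (frechet_derivative F (at w))) \<and>
     F ` U \<subseteq> S \<and> openin (top_of_set S) (F ` U) \<and>
     (\<exists>G. homeomorphism U (F ` U) F G)"

definition embedded_surface :: "(real^3) set \<Rightarrow> bool" where
  "embedded_surface S \<longleftrightarrow>
     S \<noteq> {} \<and> (\<forall>p\<in>S. \<exists>U F. local_parametrization S U F \<and> p \<in> F ` U)"

(* Properness is that of the inclusion into the whole of R^3, i.e. S is closed in R^3,
   also when S lies in a proper open subset such as a slab. A cap of a translating bowl that
   leaves a bounded slab through its boundary is therefore not properly embedded. *)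
definition properly_embedded_surface :: "(real^3) set \<Rightarrow> bool" where
  "properly_embedded_surface S \<longleftrightarrow>
     embedded_surface S \<and> proper_map (top_of_set S) euclidean (\<lambda>p. p)"

definition tangent_space :: "(real^3) set \<Rightarrow> real^3 \<Rightarrow> (real^3) set" where
  "tangent_space S p =
     {v. \<exists>U F w. local_parametrization S U F \<and> w \<in> U \<and> F w = p \<and>
           v \<in> range (frechet_derivative F (at w))}"

(* A continuous unit normal on a smooth surface is automatically smooth. *)
definition gauss_map :: "(real^3) set \<Rightarrow> (real^3 \<Rightarrow> real^3) \<Rightarrow> bool" where
  "gauss_map S N \<longleftrightarrow>
     continuous_on S N \<and>
     (\<forall>p\<in>S. norm (N p) = 1 \<and> (\<forall>v\<in>tangent_space S p. N p \<bullet> v = 0))"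


section \<open>Mean curvature vector\<close>

definition normal_part :: "real^3 \<Rightarrow> real^3 \<Rightarrow> real^3" where
  "normal_part n x = (x \<bullet> n) *\<^sub>R n"

definition first_fundamental_form :: "(real^2 \<Rightarrow> real^3) \<Rightarrow> real^2 \<Rightarrow> real^2^2" where
  "first_fundamental_form F w = (\<chi> i j. partial i F w \<bullet> partial j F w)"

(* The value of the vector-valued second fundamental form on the i-th and j-th coordinate
   fields: the Euclidean covariant derivative of the j-th along the i-th is the second partial
   derivative of F, and II is its normal part. Unaffected by replacing N by -N. *)
definition second_fundamental_form ::
  "(real^3 \<Rightarrow> real^3) \<Rightarrow> (real^2 \<Rightarrow> real^3) \<Rightarrow> real^2 \<Rightarrow> 2 \<Rightarrow> 2 \<Rightarrow> real^3" where
  "second_fundamental_form N F w i j = normal_part (N (F w)) (partial i (partial j F) w)"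

(* The metric trace (not divided by 2) of the second fundamental form at the point F w. *)
definition mean_curvature_vector ::
  "(real^3 \<Rightarrow> real^3) \<Rightarrow> (real^2 \<Rightarrow> real^3) \<Rightarrow> real^2 \<Rightarrow> real^3" where
  "mean_curvature_vector N F w =
     (\<Sum>i\<in>UNIV. \<Sum>j\<in>UNIV.
        matrix_inv (first_fundamental_form F w) $ i $ j *\<^sub>R second_fundamental_form N F w i j)"


section \<open>Minimal surfaces for a height-dependent weight\<close>

definition slab :: "ereal \<Rightarrow> ereal \<Rightarrow> (real^3) set" where
  "slab a b = {p. p \<bullet> e3 \<in> einterval a b}"

(* H = phi' e3^perp, the Euler-Lagrange equation of the weighted area with density exp phi. *)
definition phi_minimal ::
  "(real \<Rightarrow> real) \<Rightarrow> (real^3) set \<Rightarrow> (real^3 \<Rightarrow> real^3) \<Rightarrow> bool" where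
  "phi_minimal \<phi> S N \<longleftrightarrow>
     (\<forall>U F. local_parametrization S U F \<longrightarrow>
        (\<forall>w\<in>U. mean_curvature_vector N F w =
                 deriv \<phi> (F w \<bullet> e3) *\<^sub>R normal_part (N (F w)) e3))"

end

theory Submission
  imports Defs "HOL-Complex_Analysis.Great_Picard"
begin

text \<open>
  Condition (3) and monotonicity give a point \<open>p\<close> of the surface with \<open>\<phi>'(p\<^sub>3) \<noteq> 0\<close> (a zero of \<open>\<phi>'\<close>
  with \<open>\<phi>'' > 0\<close> is a strict minimum of \<open>\<phi>\<close>). Let \<open>\<sigma>\<close> be the sign of \<open>\<phi>'(p\<^sub>3)\<close>. Since \<open>N\<^sub>3 \<ge> \<epsilon>\<close> and the surface
  is closed, the points reached from \<open>p\<close> by lifting straight horizontal segments form a clopen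
  piece \<open>A\<close> of the surface whose height grows at most linearly in the horizontal distance to \<open>p\<close>.
  Hence \<open>\<sigma> q\<^sub>3 - \<delta> |q\<^sub>h - p\<^sub>h|\<^sup>2\<close> attains its maximum over \<open>A\<close> at some \<open>q\<close>. There the gradient is
  \<open>(\<sigma>/N\<^sub>3) N\<close>, and taking the metric trace of the Hessian gives \<open>\<sigma> \<phi>'(q\<^sub>3) \<le> 4\<delta>\<close>. But
  \<open>\<sigma> q\<^sub>3 \<ge> \<sigma> p\<^sub>3\<close>, so \<open>\<sigma> \<phi>'(q\<^sub>3) \<ge> |\<phi>'(p\<^sub>3)|\<close> by convexity, which is absurd for small \<open>\<delta>\<close>.
\<close>

section \<open>Lifting straight segments\<close>

text \<open>The radius \<open>e\<close> may shrink from point to point, so a largest time is used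
  instead of a uniform subdivision: the estimate from the left end holds on a closed set of times,
  and at its last time \<open>r\<close> the local estimate centred at \<open>r\<close> pushes it
  further with the same \<open>B\<close>.\<close>

lemma pointwise_lipschitz_imp_lipschitz_interval:
  fixes c :: "real \<Rightarrow> 'a::metric_space"
  assumes cont: "continuous_on {a..b} c"
    and loc: "\<And>t. t \<in> {a..b} \<Longrightarrow>
      \<exists>e>0. \<forall>s\<in>{a..b}. \<bar>s - t\<bar> < e \<longrightarrow> dist (c s) (c t) \<le> B * \<bar>s - t\<bar>"
    and "s \<in> {a..b}" "t \<in> {a..b}"
  shows "dist (c s) (c t) \<le> B * \<bar>s - t\<bar>"
proof -
  have ordered: "dist (c s) (c t) \<le> B * (t - s)" if st: "a \<le> s" "s \<le> t" "t \<le> b" for s t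
  proof -
    define T where "T = {r \<in> {s..t}. dist (c s) (c r) \<le> B * (r - s)}"
    have "continuous_on {s..t} c"
      using cont continuous_on_subset st by fastforce
    then have "closed T"
      unfolding T_def
      by (intro continuous_closed_preimage_constant continuous_on_closed_Collect_le continuous_intros) auto
    then have "compact T"
      by (rule compact_eq_bounded_closed[THEN iffD2, OF conjI, rotated])
         (rule bounded_subset[of "{s..t}"], auto simp: T_def)
    moreover have "s \<in> T"
      using st by (auto simp: T_def)
    ultimately obtain r where r: "r \<in> T" "\<And>x. x \<in> T \<Longrightarrow> x \<le> r"
      using compact_attains_sup[of T] by blast
    have "r = t"
    proof (rule ccontr)
      assume "r \<noteq> t"
      with r have rt: "s \<le> r" "r < t" by (auto simp: T_def)
      then obtain e where e: "e > 0"
        "\<And>x. x \<in> {a..b} \<Longrightarrow> \<bar>x - r\<bar> < e \<Longrightarrow> dist (c x) (c r) \<le> B * \<bar>x - r\<bar>"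
        using loc[of r] st by auto
      \<comment> \<open>A time just past \<open>r\<close>, within reach of the estimate at
        \<open>r\<close> and capped at \<open>t\<close>.\<close>
      define x where "x = min t (r + e / 2)"
      have x: "r < x" "x \<le> t" "\<bar>x - r\<bar> < e" "x \<in> {a..b}"
        using rt e st by (auto simp: x_def min_def)
      have "dist (c s) (c x) \<le> dist (c s) (c r) + dist (c x) (c r)"
        by (rule dist_triangle2)
      also have "\<dots> \<le> B * (r - s) + B * (x - r)"
        using e(2)[OF x(4,3)] r x by (intro add_mono) (auto simp: T_def)
      also have "\<dots> = B * (x - s)"
        by (simp add: algebra_simps)
      finally have "x \<in> T"
        using x rt by (auto simp: T_def)
      with r(2) x(1) show False by fastforce
    qed
    with r show ?thesis by (simp add: T_def)
  qed
  show ?thesis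
    using ordered[of s t] ordered[of t s] assms(3,4)
    by (cases "s \<le> t") (auto simp: dist_commute)
qed

text \<open>Otherwise distinct points with equal values come arbitrarily close to \<open>K\<close>.
  Their limits lie in \<open>K\<close> and have equal values, so they coincide, and \<open>f\<close>
  is not injective near that point. The lemma serves to invert the projection around a whole lifted
  path.\<close>

lemma inj_on_nbhd_of_compact:
  fixes f :: "'a::metric_space \<Rightarrow> 'b::t2_space"
  assumes contf: "continuous_on S f" and "compact K" "K \<subseteq> S" "inj_on f K"
    and loc: "\<And>p. p \<in> K \<Longrightarrow> \<exists>r>0. inj_on f (S \<inter> ball p r)"
  obtains r where "r > 0" "inj_on f (S \<inter> (\<Union>k\<in>K. ball k r))"
proof (rule ccontr)
  assume "\<not> thesis"
  then have ninj: "\<not> inj_on f (S \<inter> (\<Union>k\<in>K. ball k (1 / Suc n)))" for n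
    using that[of "1 / Suc n"] by auto
  have "\<forall>n. \<exists>a b k l. a \<in> S \<and> b \<in> S \<and> k \<in> K \<and> l \<in> K \<and> dist k a < 1 / Suc n \<and>
      dist l b < 1 / Suc n \<and> f a = f b \<and> a \<noteq> b"
  proof
    fix n
    obtain a b where "a \<in> S \<inter> (\<Union>k\<in>K. ball k (1 / Suc n))" "b \<in> S \<inter> (\<Union>k\<in>K. ball k (1 / Suc n))"
      and ab: "f a = f b" "a \<noteq> b"
      using ninj[of n] unfolding inj_on_def by blast
    then obtain k l where "a \<in> S" "b \<in> S" "k \<in> K" "dist k a < 1 / Suc n" "l \<in> K" "dist l b < 1 / Suc n"
      by (elim IntE UN_E) (simp only: mem_ball)
    with ab show "\<exists>a b k l. a \<in> S \<and> b \<in> S \<and> k \<in> K \<and> l \<in> K \<and> dist k a < 1 / Suc n \<and>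
        dist l b < 1 / Suc n \<and> f a = f b \<and> a \<noteq> b" by blast
  qed
  then obtain a b k l where ab: "\<And>n. a n \<in> S" "\<And>n. b n \<in> S" "\<And>n. k n \<in> K" "\<And>n. l n \<in> K"
      "\<And>n. dist (k n) (a n) < 1 / Suc n" "\<And>n. dist (l n) (b n) < 1 / Suc n"
      "\<And>n. f (a n) = f (b n)" "\<And>n. a n \<noteq> b n"
    by metis
  \<comment> \<open>Compactness of the product gives one subsequence along which both sequences of
    centres converge.\<close>
  have "seq_compact (K \<times> K)"
    using \<open>compact K\<close> by (intro compact_imp_seq_compact compact_Times) 
  moreover have "\<forall>n. (k n, l n) \<in> K \<times> K"
    using ab by auto
  ultimately obtain z \<rho> where "z \<in> K \<times> K" and \<rho>: "strict_mono (\<rho> :: nat \<Rightarrow> nat)"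
    and lim: "(((\<lambda>n. (k n, l n)) \<circ> \<rho>) \<longlongrightarrow> z) sequentially"
    unfolding seq_compact_def by (metis (no_types, lifting))
  then obtain x y where xy: "x \<in> K" "y \<in> K" "z = (x, y)" by auto
  have kx: "(k \<circ> \<rho>) \<longlonglongrightarrow> x" and ly: "(l \<circ> \<rho>) \<longlonglongrightarrow> y"
    using tendsto_fst[OF lim] tendsto_snd[OF lim] xy by (auto simp: o_def)
  have small: "(\<lambda>n. 1 / real (Suc (\<rho> n))) \<longlonglongrightarrow> 0"
    using LIMSEQ_subseq_LIMSEQ[OF LIMSEQ_Suc[OF lim_1_over_n] \<rho>] by (simp add: o_def)
  have close: "(u \<circ> \<rho>) \<longlonglongrightarrow> m" if "(v \<circ> \<rho>) \<longlonglongrightarrow> m" "\<And>n. dist (v n) (u n) < 1 / Suc n"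
    for u v :: "nat \<Rightarrow> 'a" and m
  proof (rule metric_tendsto_imp_tendsto)
    show "(\<lambda>n. 1 / real (Suc (\<rho> n)) + dist ((v \<circ> \<rho>) n) m) \<longlonglongrightarrow> 0"
      using tendsto_add[OF small tendsto_dist[OF that(1) tendsto_const[of m]]] by simp
    show "\<forall>\<^sub>F n in sequentially.
        dist ((u \<circ> \<rho>) n) m \<le> dist (1 / real (Suc (\<rho> n)) + dist ((v \<circ> \<rho>) n) m) 0"
    proof (intro always_eventually allI)
      fix n
      have "dist (u (\<rho> n)) m \<le> dist (v (\<rho> n)) (u (\<rho> n)) + dist (v (\<rho> n)) m"
        by (metis dist_commute dist_triangle)
      then show "dist ((u \<circ> \<rho>) n) m \<le> dist (1 / real (Suc (\<rho> n)) + dist ((v \<circ> \<rho>) n) m) 0"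
        using that(2)[of "\<rho> n"] by (simp add: dist_real_def)
    qed
  qed
  have ax: "(a \<circ> \<rho>) \<longlonglongrightarrow> x" and bY: "(b \<circ> \<rho>) \<longlonglongrightarrow> y"
    using close[OF kx ab(5)] close[OF ly ab(6)] by auto
  have fa: "(\<lambda>n. f ((a \<circ> \<rho>) n)) \<longlonglongrightarrow> f x" and fb: "(\<lambda>n. f ((b \<circ> \<rho>) n)) \<longlonglongrightarrow> f y"
    using continuous_on_tendsto_compose[OF contf ax] continuous_on_tendsto_compose[OF contf bY]
      \<open>K \<subseteq> S\<close> xy ab by auto
  have "f x = f y"
    using LIMSEQ_unique[OF fa] fb ab(7) by (simp add: o_def)
  then have "x = y"
    using \<open>inj_on f K\<close> xy by (auto simp: inj_on_def)
  obtain r where r: "r > 0" "inj_on f (S \<inter> ball x r)"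
    using loc[OF xy(1)] by auto
  have "\<forall>\<^sub>F n in sequentially. dist ((a \<circ> \<rho>) n) x < r \<and> dist ((b \<circ> \<rho>) n) x < r"
    using tendstoD[OF ax r(1)] tendstoD[OF bY r(1)] \<open>x = y\<close> by (auto elim: eventually_elim2)
  then obtain n where "dist (a (\<rho> n)) x < r" "dist (b (\<rho> n)) x < r"
    by (auto simp: eventually_sequentially)
  with r(2) ab(1,2,7,8) show False
    by (metis IntI dist_commute inj_onD mem_ball)
qed

text \<open>Path lifting through \<open>f\<close>, restricted to segments run at constant speed. The
  end point \<open>q\<close> is recorded upstairs because \<open>f\<close> may take the value
  \<open>f q\<close> on other sheets too.\<close>

definition straight_lift ::
  "('a::topological_space \<Rightarrow> 'b::real_vector) \<Rightarrow> 'a set \<Rightarrow> 'a \<Rightarrow> 'a \<Rightarrow> (real \<Rightarrow> 'a) \<Rightarrow> bool"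
where
  "straight_lift f S p q c \<longleftrightarrow>
     continuous_on {0..1} c \<and> c ` {0..1} \<subseteq> S \<and> c 0 = p \<and> c 1 = q \<and>
     (\<forall>t\<in>{0..1}. f (c t) = (1 - t) *\<^sub>R f p + t *\<^sub>R f q)"

lemma straight_lift_dist:
  fixes f :: "'a::metric_space \<Rightarrow> 'b::real_normed_vector"
  assumes "straight_lift f S p q c" "s \<in> {0..1}" "t \<in> {0..1}"
  shows "dist (f (c s)) (f (c t)) = \<bar>s - t\<bar> * dist (f p) (f q)"
proof -
  have fc: "f (c t) = (1 - t) *\<^sub>R f p + t *\<^sub>R f q" if "t \<in> {0..1}" for t
    using assms(1) that by (simp add: straight_lift_def)
  have "f (c s) - f (c t) = (t - s) *\<^sub>R (f p - f q)"
    unfolding fc[OF assms(2)] fc[OF assms(3)] by (simp add: algebra_simps)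
  then show ?thesis
    by (simp add: dist_norm abs_minus_commute)
qed

text \<open>The image moves at constant speed and \<open>f\<close> contracts distances to a nearby
  fixed point at most by the factor \<open>M\<close>, so the lift is pointwise Lipschitz and hence
  Lipschitz. As \<open>M\<close> is the same at all points, lifts have bounded length.\<close>

lemma straight_lift_lipschitz:
  fixes f :: "'a::metric_space \<Rightarrow> 'b::real_normed_vector"
  assumes lift: "straight_lift f S p q c"
    and lip: "\<And>p. p \<in> S \<Longrightarrow> \<exists>r>0. \<forall>q\<in>S. dist q p < r \<longrightarrow> dist q p \<le> M * dist (f q) (f p)"
    and "s \<in> {0..1}" "t \<in> {0..1}"
  shows "dist (c s) (c t) \<le> M * dist (f p) (f q) * \<bar>s - t\<bar>"
proof (rule pointwise_lipschitz_imp_lipschitz_interval[OF _ _ assms(3,4)])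
  show cont: "continuous_on {0..1} c"
    using lift by (simp add: straight_lift_def)
  fix t :: real assume t: "t \<in> {0..1}"
  have "c t \<in> S" using lift t by (auto simp: straight_lift_def)
  then obtain r where r: "r > 0" "\<And>q. q \<in> S \<Longrightarrow> dist q (c t) < r \<Longrightarrow> dist q (c t) \<le> M * dist (f q) (f (c t))"
    using lip by blast
  obtain e where e: "e > 0" "\<And>s. s \<in> {0..1} \<Longrightarrow> dist s t < e \<Longrightarrow> dist (c s) (c t) < r"
    using cont t r(1) unfolding continuous_on_iff by blast
  have "dist (c s) (c t) \<le> M * dist (f p) (f q) * \<bar>s - t\<bar>" if s: "s \<in> {0..1}" "\<bar>s - t\<bar> < e" for s
  proof -
    have "dist (f (c s)) (f (c t)) = \<bar>s - t\<bar> * dist (f p) (f q)"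
      using straight_lift_dist[OF lift s(1) t] .
    moreover have "dist (c s) (c t) \<le> M * dist (f (c s)) (f (c t))"
      using lift s e by (intro r) (auto simp: straight_lift_def dist_real_def)
    ultimately show ?thesis by (simp add: ac_simps)
  qed
  then show "\<exists>e>0. \<forall>s\<in>{0..1}. \<bar>s - t\<bar> < e \<longrightarrow> dist (c s) (c t) \<le> M * dist (f p) (f q) * \<bar>s - t\<bar>"
    using e(1) by blast
qed

text \<open>Lifts with convergent end points are uniformly bounded and share a Lipschitz constant,
  so by Arzela-Ascoli a subsequence converges uniformly. The limit stays in the closed set
  \<open>S\<close> and lifts the limit segment.\<close>

lemma closed_straight_liftable:
  fixes f :: "'a::euclidean_space \<Rightarrow> 'b::real_normed_vector"
  assumes "closed S" and contf: "continuous_on S f"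
    and lip: "\<And>p. p \<in> S \<Longrightarrow> \<exists>r>0. \<forall>q\<in>S. dist q p < r \<longrightarrow> dist q p \<le> M * dist (f q) (f p)"
    and "M \<ge> 0"
  shows "closed {q. \<exists>c. straight_lift f S p q c}"
  unfolding closed_sequential_limits
proof (intro allI impI, elim conjE)
  fix x l
  assume xA: "\<forall>n. x n \<in> {q. \<exists>c. straight_lift f S p q c}" and xl: "x \<longlonglongrightarrow> l"
  then obtain c where c: "\<And>n. straight_lift f S p (x n) (c n)"
    by (auto; metis)
  have cS: "c n t \<in> S" if "t \<in> {0..1}" for n t
    using c[of n] that by (auto simp: straight_lift_def)
  have xS: "x n \<in> S" for n
    using cS[of 1 n] c[of n] by (auto simp: straight_lift_def)
  have pS: "p \<in> S"
    using cS[of 0 0] c[of 0] by (auto simp: straight_lift_def)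
  have lS: "l \<in> S"
    using \<open>closed S\<close> xS xl closed_sequentially by blast
  have fxl: "(\<lambda>n. f (x n)) \<longlonglongrightarrow> f l"
    using continuous_on_tendsto_compose[OF contf xl lS] xS by simp
  then have "Bseq (\<lambda>n. f (x n))"
    using convergentI convergent_imp_Bseq by blast
  then obtain D0 where D0: "\<And>n. norm (f (x n)) \<le> D0"
    by (auto simp: Bseq_def)
  \<comment> \<open>A common Lipschitz constant: the values \<open>f (x n)\<close> converge, so the
    segments have bounded length.\<close>
  define D where "D = M * (norm (f p) + D0)"
  have "M * dist (f p) (f (x n)) \<le> D" for n
    unfolding D_def using D0[of n] \<open>M \<ge> 0\<close> norm_triangle_ineq4[of "f p" "f (x n)"]
    by (intro mult_left_mono) (auto simp: dist_norm)
  then have clip: "dist (c n s) (c n t) \<le> D * \<bar>s - t\<bar>" if "s \<in> {0..1}" "t \<in> {0..1}" for n s t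
    using straight_lift_lipschitz[OF c lip that, of n] 
    by (meson abs_ge_zero mult_right_mono order_trans)
  have "D \<ge> 0"
    using clip[of 0 1 0] by (simp add: order_trans[OF zero_le_dist])
  have 1: "norm (c n t) \<le> norm p + D" if "t \<in> {0..1}" for n t
  proof -
    have "norm (c n t) \<le> norm p + dist (c n t) p"
      by (metis dist_norm norm_triangle_sub)
    also have "dist (c n t) p \<le> D * \<bar>t - 0\<bar>"
      using clip[of t 0 n] c[of n] that by (simp add: straight_lift_def)
    also have "\<dots> \<le> D" using that \<open>D \<ge> 0\<close> by (simp add: mult_left_le)
    finally show ?thesis by simp
  qed
  have 2: "\<exists>d>0. \<forall>n s. s \<in> {0..1} \<and> norm (t - s) < d \<longrightarrow> norm (c n t - c n s) < e"
    if "t \<in> {0..1}" "e > 0" for t e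
  proof (intro exI conjI allI impI)
    \<comment> \<open>The summand 1 covers the case \<open>D = 0\<close>.\<close>
    show "e / (D + 1) > 0" using that \<open>D \<ge> 0\<close> by simp
    fix n s assume s: "s \<in> {0..1} \<and> norm (t - s) < e / (D + 1)"
    have "norm (c n t - c n s) \<le> D * \<bar>t - s\<bar>"
      using clip[of t s n] s that by (simp add: dist_norm)
    also have "\<dots> \<le> (D + 1) * \<bar>t - s\<bar>" by (simp add: algebra_simps)
    also have "\<dots> < e" using s \<open>D \<ge> 0\<close> by (simp add: field_simps)
    finally show "norm (c n t - c n s) < e" .
  qed
  obtain g k where g: "continuous_on {0..1} g" and k: "strict_mono (k :: nat \<Rightarrow> nat)"
    and unif: "\<And>e. 0 < e \<Longrightarrow> \<exists>N. \<forall>n t. n \<ge> N \<and> t \<in> {0..1} \<longrightarrow> norm (c (k n) t - g t) < e"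
    using Arzela_Ascoli[of "{0..1::real}" c "norm p + D", OF compact_Icc 1 2] by metis
  have lim: "(\<lambda>n. c (k n) t) \<longlonglongrightarrow> g t" if "t \<in> {0..1}" for t
    unfolding LIMSEQ_iff using unif that by blast
  have gS: "g t \<in> S" if "t \<in> {0..1}" for t
    by (rule closed_sequentially[OF \<open>closed S\<close> _ lim[OF that]]) (rule cS[OF that])
  have "g 0 = p"
    using LIMSEQ_unique[OF lim[of 0]] c by (simp add: straight_lift_def)
  moreover have "g 1 = l"
    using LIMSEQ_unique[OF lim[of 1]] LIMSEQ_subseq_LIMSEQ[OF xl k] c
    by (simp add: straight_lift_def o_def)
  moreover have "f (g t) = (1 - t) *\<^sub>R f p + t *\<^sub>R f l" if t: "t \<in> {0..1}" for t
  proof (rule LIMSEQ_unique)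
    show "(\<lambda>n. f (c (k n) t)) \<longlonglongrightarrow> f (g t)"
      using continuous_on_tendsto_compose[OF contf lim[OF t] gS[OF t]] cS[OF t] by simp
    have "(\<lambda>n. (1 - t) *\<^sub>R f p + t *\<^sub>R f (x (k n))) \<longlonglongrightarrow> (1 - t) *\<^sub>R f p + t *\<^sub>R f l"
      using LIMSEQ_subseq_LIMSEQ[OF fxl k] by (intro tendsto_intros) (simp add: o_def)
    then show "(\<lambda>n. f (c (k n) t)) \<longlonglongrightarrow> (1 - t) *\<^sub>R f p + t *\<^sub>R f l"
      using c t by (simp add: straight_lift_def)
  qed
  ultimately have "straight_lift f S p l g"
    using g gS by (auto simp: straight_lift_def)
  then show "l \<in> {q. \<exists>c. straight_lift f S p q c}" by blast
qed

text \<open>Around a given lift \<open>f\<close> has a continuous inverse \<open>g\<close> on an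
  open set. Segments with nearby end points stay in that open set, and \<open>g\<close> carries them
  back to lifts.\<close>

lemma openin_straight_liftable:
  fixes f :: "'a::metric_space \<Rightarrow> 'b::real_normed_vector"
  assumes contf: "continuous_on S f"
    and lip: "\<And>p. p \<in> S \<Longrightarrow> \<exists>r>0. \<forall>q\<in>S. dist q p < r \<longrightarrow> dist q p \<le> M * dist (f q) (f p)"
    and inj: "\<And>p. p \<in> S \<Longrightarrow> \<exists>r>0. inj_on f (S \<inter> ball p r)"
    and opn: "\<And>W. openin (top_of_set S) W \<Longrightarrow> open (f ` W)"
  shows "openin (top_of_set S) {q. \<exists>c. straight_lift f S p q c}"
proof (subst openin_subopen, intro ballI)
  fix q assume "q \<in> {q. \<exists>c. straight_lift f S p q c}"
  then obtain c where c: "straight_lift f S p q c" by blast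
  then have contc: "continuous_on {0..1} c" and cS: "c ` {0..1} \<subseteq> S" and c0: "c 0 = p" and c1: "c 1 = q"
    and fc: "\<And>t. t \<in> {0..1} \<Longrightarrow> f (c t) = (1 - t) *\<^sub>R f p + t *\<^sub>R f q"
    by (auto simp: straight_lift_def)
  \<comment> \<open>Injectivity is claimed on the image of \<open>c\<close>: if
    \<open>f p = f q\<close>, the Lipschitz bound makes the lift constant.\<close>
  have cinj: "inj_on f (c ` {0..1})"
  proof (clarsimp simp only: inj_on_def ball_simps)
    fix s t :: real assume st: "s \<in> {0..1}" "t \<in> {0..1}" "f (c s) = f (c t)"
    have "dist (c s) (c t) \<le> M * dist (f (c s)) (f (c t))"
      using straight_lift_lipschitz[OF c lip st(1,2)] straight_lift_dist[OF c st(1,2)] by (simp add: ac_simps)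
    with st(3) show "c s = c t" by simp
  qed
  have "compact (c ` {0..1})"
    using contc compact_continuous_image compact_Icc by blast
  then obtain r where r: "r > 0" "inj_on f (S \<inter> (\<Union>k\<in>c ` {0..1}. ball k r))"
    using inj_on_nbhd_of_compact[OF contf _ cS cinj] inj cS by blast
  define V where "V = S \<inter> (\<Union>k\<in>c ` {0..1}. ball k r)"
  have Vopen: "openin (top_of_set S) V"
    unfolding V_def by (intro openin_open_Int open_UN) auto
  have Vinj: "inj_on f V" using r by (simp add: V_def)
  have cV: "c ` {0..1} \<subseteq> V" using cS r(1) by (force simp: V_def)
  have VS: "V \<subseteq> S" by (auto simp: V_def)
  define g where "g = inv_into V f"
  have gf: "g (f x) = x" if "x \<in> V" for x
    using Vinj that by (simp add: g_def)
  have gV: "g y \<in> V" "f (g y) = y" if "y \<in> f ` V" for y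
    using that by (auto simp: g_def inv_into_into f_inv_into_f)
  have contg: "continuous_on (f ` V) g"
  proof (rule continuous_on_inverse_open_map[OF _ refl])
    show "continuous_on V f" using contf VS continuous_on_subset by blast
    show "g (f x) = x" if "x \<in> V" for x using gf that .
    fix W assume "openin (top_of_set V) W"
    then have W: "openin (top_of_set S) W" "W \<subseteq> V"
      using Vopen openin_trans openin_imp_subset by blast+
    then show "openin (top_of_set (f ` V)) (f ` W)"
      using opn by (intro open_openin_trans) (auto simp: opn Vopen)
  qed
  have "open (f ` V)" using opn Vopen by blast
  moreover have "compact (f ` c ` {0..1})"
    using \<open>compact (c ` {0..1})\<close> contf cS compact_continuous_image continuous_on_subset by blast
  moreover have "f ` c ` {0..1} \<subseteq> f ` V" using cV by blast
  ultimately obtain e where e: "e > 0" "(\<Union>y\<in>f ` c ` {0..1}. ball y e) \<subseteq> f ` V"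
    using compact_subset_open_imp_ball_epsilon_subset by metis
  define W where "W = V \<inter> f -` ball (f q) e"
  have "openin (top_of_set S) (S \<inter> f -` ball (f q) e)"
    using contf by (intro continuous_openin_preimage_gen) auto
  then have "openin (top_of_set S) (V \<inter> (S \<inter> f -` ball (f q) e))"
    using Vopen openin_Int by blast
  then have Wopen: "openin (top_of_set S) W"
    using VS by (simp add: W_def Int_absorb2 flip: Int_assoc)
  have "q \<in> W"
    using cV c1 e(1) by (force simp: W_def)
  moreover have "W \<subseteq> {q. \<exists>c. straight_lift f S p q c}"
  proof
    fix x assume "x \<in> W"
    then have x: "x \<in> V" "dist (f q) (f x) < e" by (auto simp: W_def)
    define l where "l = (\<lambda>t::real. (1 - t) *\<^sub>R f p + t *\<^sub>R f x)"
    have l: "l t \<in> f ` V" if t: "t \<in> {0..1}" for t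
    proof -
      \<comment> \<open>Both segments start at \<open>f p\<close>, so at time \<open>t\<close> they
        differ by at most the distance of their end points.\<close>
      have "f (c t) - l t = t *\<^sub>R (f q - f x)"
        using fc[OF t] by (simp add: l_def algebra_simps)
      then have "dist (f (c t)) (l t) = t * dist (f q) (f x)"
        using t by (simp add: dist_norm)
      also have "\<dots> \<le> dist (f q) (f x)"
        using t by (simp add: mult_left_le_one_le)
      finally show ?thesis using e(2) x(2) t by force
    qed
    have "continuous_on {0..1} (\<lambda>t. g (l t))"
      using l by (intro continuous_on_compose2[OF contg]) (auto simp: l_def intro!: continuous_intros)
    moreover have "g (l 0) = p"
      using gf[of p] cV c0 by (force simp: l_def)
    moreover have "g (l 1) = x"
      using gf x by (simp add: l_def)
    moreover have "g (l t) \<in> S" "f (g (l t)) = l t" if "t \<in> {0..1}" for t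
      using gV[OF l[OF that]] VS by auto
    ultimately have "straight_lift f S p x (\<lambda>t. g (l t))"
      by (auto simp: straight_lift_def l_def)
    then show "x \<in> {q. \<exists>c. straight_lift f S p q c}" by blast
  qed
  ultimately show "\<exists>T. openin (top_of_set S) T \<and> q \<in> T \<and> T \<subseteq> {q. \<exists>c. straight_lift f S p q c}"
    using Wopen by blast
qed

text \<open>The sheet \<open>A\<close> consists of the end points of all lifts starting at
  \<open>p\<close>. Its distance bound is the Lipschitz estimate between the times 0 and 1.\<close>

lemma clopen_sheet:
  fixes f :: "'a::euclidean_space \<Rightarrow> 'b::real_normed_vector"
  assumes "closed S" "continuous_on S f" "M \<ge> 0" "p \<in> S"
    and lip: "\<And>p. p \<in> S \<Longrightarrow> \<exists>r>0. \<forall>q\<in>S. dist q p < r \<longrightarrow> dist q p \<le> M * dist (f q) (f p)"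
    and "\<And>p. p \<in> S \<Longrightarrow> \<exists>r>0. inj_on f (S \<inter> ball p r)"
    and "\<And>W. openin (top_of_set S) W \<Longrightarrow> open (f ` W)"
  obtains A where "closed A" "openin (top_of_set S) A" "p \<in> A"
    "\<And>q. q \<in> A \<Longrightarrow> dist q p \<le> M * dist (f q) (f p)"
proof
  show "closed {q. \<exists>c. straight_lift f S p q c}"
    using assms closed_straight_liftable by blast
  show "openin (top_of_set S) {q. \<exists>c. straight_lift f S p q c}"
    using assms openin_straight_liftable by blast
  have "straight_lift f S p p (\<lambda>t. p)"
    using \<open>p \<in> S\<close> by (auto simp: straight_lift_def simp flip: scaleR_left.add)
  then show "p \<in> {q. \<exists>c. straight_lift f S p q c}" by blast
  fix q assume "q \<in> {q. \<exists>c. straight_lift f S p q c}"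
  then obtain c where c: "straight_lift f S p q c" by blast
  show "dist q p \<le> M * dist (f q) (f p)"
    using straight_lift_lipschitz[OF c lip, of 1 0] c
    by (auto simp: straight_lift_def dist_commute)
qed


section \<open>Smooth functions and second derivatives\<close>

lemma smooth_on_differentiable:
  assumes "smooth_on S f" "x \<in> S"
  shows "(f has_derivative frechet_derivative f (at x)) (at x)"
proof -
  have "Cn_on (Suc 0) S f" using assms(1) by (simp only: smooth_on_def)
  with assms(2) show ?thesis by (simp add: frechet_derivative_works[symmetric])
qed

lemma smooth_on_frechet_derivative:
  assumes "smooth_on S f"
  shows "smooth_on S (\<lambda>x. frechet_derivative f (at x) v)"
  unfolding smooth_on_def
proof
  fix n
  have "Cn_on (Suc n) S f" using assms by (simp only: smooth_on_def)
  then show "Cn_on n S (\<lambda>x. frechet_derivative f (at x) v)" by simp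
qed

lemma smooth_on_continuous_on: "smooth_on S f \<Longrightarrow> continuous_on S f"
  unfolding smooth_on_def by (drule spec[of _ 0]) simp

lemma deriv_eq_frechet_derivative:
  fixes f :: "real \<Rightarrow> real"
  assumes "(f has_derivative frechet_derivative f (at x)) (at x)"
  shows "deriv f x = frechet_derivative f (at x) 1"
proof -
  have "linear (frechet_derivative f (at x))"
    using assms by (rule has_derivative_linear)
  then have "frechet_derivative f (at x) h = frechet_derivative f (at x) 1 * h" for h
    using linear_scale[of "frechet_derivative f (at x)" h 1] by simp
  then have "frechet_derivative f (at x) = (*) (frechet_derivative f (at x) 1)"
    by blast
  with assms have "(f has_field_derivative frechet_derivative f (at x) 1) (at x)"
    unfolding has_field_derivative_def by simp
  then show ?thesis by (rule DERIV_imp_deriv)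
qed

lemma smooth_on_deriv:
  fixes f :: "real \<Rightarrow> real"
  assumes "open S" "smooth_on S f" "x \<in> S"
  shows "(f has_real_derivative deriv f x) (at x)"
    and "(deriv f has_real_derivative deriv (deriv f) x) (at x)"
proof -
  have *: "(f has_real_derivative deriv f x) (at x)" if "smooth_on S f" "x \<in> S" for x and f :: "real \<Rightarrow> real"
    using smooth_on_differentiable[OF that]
    by (meson DERIV_deriv_iff_real_differentiable differentiable_def)
  then show "(f has_real_derivative deriv f x) (at x)" using assms by blast
  let ?g = "\<lambda>x. frechet_derivative f (at x) 1"
  have "(?g has_real_derivative deriv ?g x) (at x)"
    using * smooth_on_frechet_derivative[OF assms(2)] assms(3) by blast
  \<comment> \<open>\<open>deriv f\<close> is known to agree with \<open>?g\<close> only on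
    \<open>S\<close>, which is open, so the derivative carries over at \<open>x\<close>.\<close>
  then have "(deriv f has_real_derivative deriv ?g x) (at x)"
    by (rule has_field_derivative_transform_within_open[OF _ assms(1,3)])
       (simp only: deriv_eq_frechet_derivative[OF smooth_on_differentiable[OF assms(2)]])
  then show "(deriv f has_real_derivative deriv (deriv f) x) (at x)"
    by (metis DERIV_imp_deriv)
qed

text \<open>If \<open>c\<close> were positive, \<open>h'\<close> would be positive just to the right
  of 0, and the mean value theorem would give values above \<open>h 0\<close>. It will be applied
  along lines in the parameter plane.\<close>

lemma local_max_second_derivative:
  fixes h :: "real \<Rightarrow> real"
  assumes "d > 0"
    and h': "\<And>t. \<bar>t\<bar> < d \<Longrightarrow> (h has_real_derivative h' t) (at t)"
    and h'': "(h' has_real_derivative c) (at 0)"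
    and max: "\<And>t. \<bar>t\<bar> < d \<Longrightarrow> h t \<le> h 0"
  shows "h' 0 = 0" and "c \<le> 0"
proof -
  show crit: "h' 0 = 0"
    using DERIV_local_max[OF h'[of 0] \<open>d > 0\<close>] max \<open>d > 0\<close> by auto
  show "c \<le> 0"
  proof (rule ccontr)
    assume "\<not> c \<le> 0"
    then obtain e where e: "e > 0" "\<And>t. 0 < t \<Longrightarrow> t < e \<Longrightarrow> 0 < h' t"
      using DERIV_pos_inc_right[OF h''] crit by auto
    define t where "t = min d e / 2"
    have t: "0 < t" "t < d" "t < e" using e(1) \<open>d > 0\<close> by (auto simp: t_def)
    obtain s where s: "0 < s" "s < t" "h t - h 0 = (t - 0) * h' s"
      using MVT2[of 0 t h h'] h' t by auto
    then have "h t > h 0"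
      using e(2)[of s] t by (simp add: mult_pos_pos algebra_simps)
    with max[of t] t show False by simp
  qed
qed

text \<open>On the range of \<open>D\<close> the projection loses at most the factor
  \<open>K\<close>. Since \<open>D\<close> is bounded below, the first order error is a small
  multiple of \<open>D (y - x)\<close> and can be absorbed at the price of doubling
  \<open>K\<close>.\<close>

lemma has_derivative_imp_projection_expanding:
  fixes f :: "'a::euclidean_space \<Rightarrow> 'b::euclidean_space" and P :: "'b \<Rightarrow> 'c::euclidean_space"
  assumes der: "(f has_derivative D) (at x)"
    and P: "linear P" "\<And>u. norm (P u) \<le> norm u"
    and "inj D" "K > 0" and K: "\<And>v. norm (D v) \<le> K * norm (P (D v))"
  shows "\<exists>r>0. \<forall>y. norm (y - x) < r \<longrightarrow> norm (f y - f x) \<le> 2 * K * norm (P (f y) - P (f x))"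
proof -
  have "linear D" using der by (rule has_derivative_linear)
  then obtain m where m: "m > 0" "\<And>v. m * norm v \<le> norm (D v)"
    using linear_inj_bounded_below_pos \<open>inj D\<close> by blast
  \<comment> \<open>Chosen so that \<open>2 * \<tau> * K = 1 - \<tau>\<close>: absorbing the error
    leaves \<open>(1 + \<tau>) * d\<close>, which is exactly the bound for
    \<open>norm (f y - f x)\<close>.\<close>
  define \<tau> where "\<tau> = 1 / (1 + 2 * K)"
  have \<tau>: "\<tau> > 0" "\<tau> * (1 + 2 * K) = 1" using \<open>K > 0\<close> by (auto simp: \<tau>_def)
  obtain r where r: "r > 0"
    "\<And>y. norm (y - x) < r \<Longrightarrow> norm (f y - f x - D (y - x)) \<le> (\<tau> * m) * norm (y - x)"
    using der \<tau> m unfolding has_derivative_at_alt by (meson mult_pos_pos)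
  have "norm (f y - f x) \<le> 2 * K * norm (P (f y) - P (f x))" if "norm (y - x) < r" for y
  proof -
    define d where "d = norm (D (y - x))"
    define \<rho> where "\<rho> = f y - f x - D (y - x)"
    have "(\<tau> * m) * norm (y - x) \<le> \<tau> * d"
      using m(2)[of "y - x"] \<tau> by (simp add: d_def)
    with r(2)[OF that] have \<rho>: "norm \<rho> \<le> \<tau> * d" by (simp add: \<rho>_def)
    have "norm (f y - f x) \<le> d + norm \<rho>"
      using norm_triangle_ineq[of "D (y - x)" \<rho>] by (simp add: \<rho>_def d_def)
    also have "\<dots> \<le> d + \<tau> * d" using \<rho> by simp
    finally have 1: "norm (f y - f x) \<le> d + \<tau> * d" .
    have "P (f y) - P (f x) = P (D (y - x)) + P \<rho>"
      by (simp add: \<rho>_def linear_diff[OF P(1)])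
    then have "norm (P (D (y - x))) - norm (P \<rho>) \<le> norm (P (f y) - P (f x))"
      using norm_diff_ineq[of "P (D (y - x))" "P \<rho>"] by simp
    then have "norm (P (D (y - x))) \<le> norm (P (f y) - P (f x)) + \<tau> * d"
      using P(2)[of \<rho>] \<rho> by linarith
    then have "d \<le> K * (norm (P (f y) - P (f x)) + \<tau> * d)"
      using K[of "y - x"] \<open>K > 0\<close> unfolding d_def
      by (meson less_imp_le mult_left_mono order_trans)
    then have "2 * d \<le> 2 * K * norm (P (f y) - P (f x)) + (\<tau> * (2 * K)) * d"
      by (simp add: algebra_simps)
    also have "\<tau> * (2 * K) = 1 - \<tau>" using \<tau>(2) by (simp add: algebra_simps)
    finally show ?thesis using 1 by (simp add: algebra_simps)
  qed
  with r(1) show ?thesis by blast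
qed

text \<open>Smoothness gives continuity of the derivative in each fixed direction. Expanding
  \<open>v\<close> in the finite basis makes it uniform in \<open>v\<close>, as the local
  injectivity theorem requires.\<close>

lemma smooth_on_frechet_derivative_close:
  fixes f :: "'a::euclidean_space \<Rightarrow> 'b::real_normed_vector"
  assumes "open U" "smooth_on U f" "w \<in> U" "e > 0"
  obtains d where "d > 0" "ball w d \<subseteq> U"
    "\<And>x v. x \<in> ball w d \<Longrightarrow> norm (frechet_derivative f (at x) v - frechet_derivative f (at w) v) \<le> e * norm v"
proof -
  let ?D = "\<lambda>x. frechet_derivative f (at x)"
  have lin: "linear (?D x)" if "x \<in> U" for x
    using smooth_on_differentiable[OF assms(2) that] by (rule has_derivative_linear)
  have "isCont (\<lambda>x. ?D x b) w" for b
    using smooth_on_continuous_on[OF smooth_on_frechet_derivative[OF assms(2)]] assms(1,3)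
    by (simp add: continuous_on_eq_continuous_at)
  then have "isCont (\<lambda>x. \<Sum>b\<in>Basis. norm (?D x b - ?D w b)) w"
    by (intro continuous_intros)
  then have "((\<lambda>x. \<Sum>b\<in>Basis. norm (?D x b - ?D w b)) \<longlongrightarrow> 0) (at w)"
    by (simp add: isCont_def)
  then have "\<forall>\<^sub>F x in at w. (\<Sum>b\<in>Basis. norm (?D x b - ?D w b)) < e"
    using \<open>e > 0\<close> by (rule order_tendstoD)
  then obtain d1 where d1: "d1 > 0" "\<And>x. x \<noteq> w \<Longrightarrow> dist x w < d1 \<Longrightarrow> (\<Sum>b\<in>Basis. norm (?D x b - ?D w b)) < e"
    unfolding eventually_at by blast
  obtain d2 where d2: "d2 > 0" "ball w d2 \<subseteq> U"
    using assms(1,3) openE by blast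
  have close: "norm (?D x v - ?D w v) \<le> e * norm v" if x: "x \<in> ball w (min d1 d2)" for x v
  proof (cases "x = w")
    case False
    have xU: "x \<in> U" using x d2 by auto
    have expand: "?D y v = (\<Sum>b\<in>Basis. (v \<bullet> b) *\<^sub>R ?D y b)" if "y \<in> U" for y
    proof -
      have "?D y v = ?D y (\<Sum>b\<in>Basis. (v \<bullet> b) *\<^sub>R b)" by (simp add: euclidean_representation)
      also have "\<dots> = (\<Sum>b\<in>Basis. (v \<bullet> b) *\<^sub>R ?D y b)"
        using lin[OF that] by (simp add: linear_sum linear_scale o_def)
      finally show ?thesis .
    qed
    have "norm (?D x v - ?D w v) = norm (\<Sum>b\<in>Basis. (v \<bullet> b) *\<^sub>R (?D x b - ?D w b))"
      by (simp add: expand[OF xU] expand[OF \<open>w \<in> U\<close>] sum_subtractf scaleR_diff_right)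
    also have "\<dots> \<le> (\<Sum>b\<in>Basis. norm v * norm (?D x b - ?D w b))"
      by (rule order_trans[OF norm_sum])
         (auto intro!: sum_mono mult_right_mono simp: Basis_le_norm)
    also have "\<dots> = (\<Sum>b\<in>Basis. norm (?D x b - ?D w b)) * norm v"
      by (simp add: sum_distrib_left[symmetric] mult.commute)
    also have "\<dots> \<le> e * norm v"
      using d1(2)[OF False] x by (intro mult_right_mono) (auto simp: dist_commute)
    finally show ?thesis .
  qed (use \<open>e > 0\<close> in simp)
  have "ball w (min d1 d2) \<subseteq> U" using d2(2) by auto
  then show thesis
    using that[of "min d1 d2", OF _ _ close] d1(1) d2(1) by simp
qed

lemma has_derivative_partial:
  fixes F :: "real^2 \<Rightarrow> 'b::real_normed_vector"
  assumes "(F has_derivative frechet_derivative F (at x)) (at x)"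
  shows "frechet_derivative F (at x) v = (\<Sum>i\<in>UNIV. v $ i *\<^sub>R partial i F x)"
proof -
  have lin: "linear (frechet_derivative F (at x))"
    using assms by (rule has_derivative_linear)
  have "v = (\<Sum>i\<in>UNIV. v $ i *\<^sub>R axis i 1)"
    using basis_expansion[of v] by (simp add: scalar_mult_eq_scaleR)
  then have "frechet_derivative F (at x) v = frechet_derivative F (at x) (\<Sum>i\<in>UNIV. v $ i *\<^sub>R axis i 1)"
    by simp
  also have "\<dots> = (\<Sum>i\<in>UNIV. v $ i *\<^sub>R partial i F x)"
    by (simp add: linear_sum[OF lin] linear_scale[OF lin] partial_def)
  finally show ?thesis .
qed

lemma smooth_on_partial: "smooth_on U F \<Longrightarrow> smooth_on U (partial i F)"
  using smooth_on_frechet_derivative[of U F "axis i 1"] by (simp add: partial_def[abs_def])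

lemma has_vector_derivative_along_line:
  assumes "(f has_derivative D) (at (w + t *\<^sub>R v))"
  shows "((\<lambda>t. f (w + t *\<^sub>R v)) has_vector_derivative D v) (at t)"
proof -
  have "((\<lambda>t. w + t *\<^sub>R v) has_derivative (\<lambda>s. s *\<^sub>R v)) (at t)"
    by (auto intro!: derivative_eq_intros)
  from diff_chain_at[OF this] assms
  have "((\<lambda>t. f (w + t *\<^sub>R v)) has_derivative (\<lambda>s. D (s *\<^sub>R v))) (at t)"
    by (simp add: o_def)
  moreover have "linear D" using assms by (rule has_derivative_linear)
  ultimately show ?thesis
    by (simp add: has_vector_derivative_def linear_scale)
qed

lemma has_real_derivative_inner:
  fixes f g :: "real \<Rightarrow> 'a::real_inner"
  assumes "(f has_vector_derivative f') (at t)" "(g has_vector_derivative g') (at t)"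
  shows "((\<lambda>t. f t \<bullet> g t) has_real_derivative f t \<bullet> g' + f' \<bullet> g t) (at t)"
  using bounded_bilinear.has_vector_derivative[OF bounded_bilinear_inner assms]
  by (simp add: has_real_derivative_iff_has_vector_derivative)


section \<open>Metric traces\<close>

lemma matrix_inv_eqI:
  fixes A :: "real^'n^'n"
  assumes "A ** B = mat 1" "B ** A = mat 1"
  shows "matrix_inv A = B"
proof -
  \<comment> \<open>\<open>matrix_inv\<close> is a choice among two-sided inverses; \<open>B\<close>
    shows that one exists.\<close>
  have "A ** matrix_inv A = mat 1 \<and> matrix_inv A ** A = mat 1"
    unfolding matrix_inv_def by (rule someI[of _ B]) (use assms in simp)
  then show ?thesis
    by (metis assms(1) matrix_mul_assoc matrix_mul_lid matrix_mul_rid)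
qed

lemma matrix_inv_2:
  fixes G :: "real^2^2"
  assumes "det G \<noteq> 0"
  shows "matrix_inv G = vector [vector [G$2$2 / det G, - G$1$2 / det G],
                                vector [- G$2$1 / det G, G$1$1 / det G]]"
proof (rule matrix_inv_eqI)
  have *: "G$1$1 * G$2$2 - G$1$2 * G$2$1 \<noteq> 0" using assms by (simp add: det_2)
  show "G ** vector [vector [G$2$2 / det G, - G$1$2 / det G],
      vector [- G$2$1 / det G, G$1$1 / det G]] = mat 1"
    using * by (simp add: vec_eq_iff forall_2 matrix_matrix_mult_def sum_2 mat_def det_2 divide_simps)
  show "vector [vector [G$2$2 / det G, - G$1$2 / det G],
      vector [- G$2$1 / det G, G$1$1 / det G]] ** G = mat 1"
    using * by (simp add: vec_eq_iff forall_2 matrix_matrix_mult_def sum_2 mat_def det_2 divide_simps)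
qed

text \<open>The trace is the sum of the values of the form \<open>M\<close> on a \<open>G\<close>-orthonormal basis.\<close>
lemma trace_matrix_inv_nonpos:
  fixes G :: "real^2^2" and M :: "2 \<Rightarrow> 2 \<Rightarrow> real"
  assumes sym: "G$2$1 = G$1$2" and "G$1$1 > 0" "det G > 0"
    and M: "\<And>x y. x\<^sup>2 * M 1 1 + x * y * (M 1 2 + M 2 1) + y\<^sup>2 * M 2 2 \<le> 0"
  shows "(\<Sum>i\<in>UNIV. \<Sum>j\<in>UNIV. matrix_inv G $ i $ j * M i j) \<le> 0"
proof -
  let ?S = "G$2$2 * M 1 1 - G$1$2 * (M 1 2 + M 2 1) + G$1$1 * M 2 2"
  \<comment> \<open>The vectors \<open>(1, 0)\<close> and \<open>(- G$1$2, G$1$1)\<close> are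
    \<open>G\<close>-orthogonal with squared lengths \<open>G$1$1\<close> and
    \<open>G$1$1 * det G\<close>; denominators are cleared.\<close>
  have "G$1$1 * ?S = ((- G$1$2)\<^sup>2 * M 1 1 + - G$1$2 * G$1$1 * (M 1 2 + M 2 1) + (G$1$1)\<^sup>2 * M 2 2)
      + det G * (1\<^sup>2 * M 1 1 + 1 * 0 * (M 1 2 + M 2 1) + 0\<^sup>2 * M 2 2)"
    by (simp add: det_2 sym power2_eq_square algebra_simps)
  also have "\<dots> \<le> 0"
    using M[of "- G$1$2" "G$1$1"] mult_nonneg_nonpos[OF less_imp_le[OF \<open>det G > 0\<close>] M[of 1 0]] by linarith
  finally have "?S \<le> 0" using \<open>G$1$1 > 0\<close> by (simp add: mult_le_0_iff)
  moreover have "(\<Sum>i\<in>UNIV. \<Sum>j\<in>UNIV. matrix_inv G $ i $ j * M i j) = ?S / det G"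
    using \<open>det G > 0\<close> by (simp add: matrix_inv_2 sum_2 sym field_simps)
  ultimately show ?thesis
    using \<open>det G > 0\<close> by (simp add: divide_le_0_iff)
qed

text \<open>The trace of the identity in dimension two, which turns the Hessian bound with
  \<open>2 * \<delta>\<close> into \<open>4 * \<delta>\<close>.\<close>

lemma trace_matrix_inv_self:
  fixes G :: "real^2^2"
  assumes "G$2$1 = G$1$2" "det G > 0"
  shows "(\<Sum>i\<in>UNIV. \<Sum>j\<in>UNIV. matrix_inv G $ i $ j * G $ i $ j) = 2"
  using assms by (simp add: matrix_inv_2 sum_2 field_simps) (simp add: det_2 algebra_simps)


section \<open>Horizontal projection of a transverse surface\<close>

definition horizontal :: "real^3 \<Rightarrow> real^2" where
  "horizontal x = vector [x $ 1, x $ 2]"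

lemma linear_horizontal: "linear horizontal"
  by (rule linearI) (simp_all add: horizontal_def vec_eq_iff forall_2)

lemma bounded_linear_horizontal: "bounded_linear horizontal"
  using linear_horizontal by (simp add: linear_conv_bounded_linear)

lemma norm_eq_horizontal: "(norm x)\<^sup>2 = (norm (horizontal x))\<^sup>2 + (x $ 3)\<^sup>2"
  unfolding power2_norm_eq_inner by (simp add: horizontal_def inner_vec_def sum_2 sum_3 power2_eq_square)

lemma inner_eq_horizontal: "x \<bullet> y = horizontal x \<bullet> horizontal y + x $ 3 * y $ 3"
  by (simp add: horizontal_def inner_vec_def sum_2 sum_3)

lemma norm_horizontal_le: "norm (horizontal x) \<le> norm x"
  by (rule power2_le_imp_le) (simp_all add: norm_eq_horizontal)

lemma norm_le_horizontal: "norm x \<le> norm (horizontal x) + \<bar>x $ 3\<bar>"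
  by (rule power2_le_imp_le) (auto simp: norm_eq_horizontal power2_sum)

lemma inner_e3: "x \<bullet> e3 = x $ 3"
  by (simp add: inner_axis)

lemma local_parametrization_smooth:
  assumes "local_parametrization S U F"
  shows "open U" "smooth_on U F"
    and "w \<in> U \<Longrightarrow> (F has_derivative frechet_derivative F (at w)) (at w)"
    and "w \<in> U \<Longrightarrow> inj (frechet_derivative F (at w))"
  using assms by (auto simp: local_parametrization_def intro: smooth_on_differentiable)

lemma local_parametrization_tangent:
  assumes "local_parametrization S U F" "gauss_map S N" "w \<in> U"
  shows "F w \<in> S" "norm (N (F w)) = 1" "N (F w) \<bullet> frechet_derivative F (at w) v = 0"
proof -
  show "F w \<in> S" using assms by (auto simp: local_parametrization_def)
  moreover have "frechet_derivative F (at w) v \<in> tangent_space S (F w)"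
    using assms unfolding tangent_space_def by blast
  ultimately show "norm (N (F w)) = 1" "N (F w) \<bullet> frechet_derivative F (at w) v = 0"
    using assms(2) by (auto simp: gauss_map_def)
qed

text \<open>Embeddedness enters here: \<open>F\<close> is a homeomorphism onto a relatively open
  piece of \<open>S\<close>, so no other part of \<open>S\<close> comes close to \<open>F w\<close>,
  and estimates in the parameter plane become estimates on \<open>S\<close>.\<close>

lemma local_parametrization_nbhd:
  assumes par: "local_parametrization S U F" and "w \<in> U" "open T" "w \<in> T"
  obtains r where "r > 0" "S \<inter> ball (F w) r \<subseteq> F ` (U \<inter> T)"
proof -
  obtain G where "homeomorphism U (F ` U) F G"
    using par by (auto simp: local_parametrization_def)
  then have "openin (top_of_set (F ` U)) (F ` (U \<inter> T))"
    using \<open>open T\<close> by (intro homeomorphism_imp_open_map[where g = G]) (auto simp: openin_open_Int)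
  then have "openin (top_of_set S) (F ` (U \<inter> T))"
    using par openin_trans unfolding local_parametrization_def by blast
  moreover have "F w \<in> F ` (U \<inter> T)" using assms by blast
  ultimately obtain r where "r > 0" "ball (F w) r \<inter> S \<subseteq> F ` (U \<inter> T)"
    unfolding openin_contains_ball by blast
  then show thesis using that by (simp add: Int_commute)
qed

text \<open>Orthogonality to \<open>n\<close> expresses \<open>n $ 3 * v $ 3\<close> through the
  horizontal parts, so the slope of \<open>v\<close> is at most
  \<open>1 / \<epsilon>\<close>.\<close>

lemma norm_le_horizontal_of_transverse:
  assumes "norm n = 1" "n \<bullet> v = 0" "\<epsilon> > 0" "\<epsilon> \<le> n $ 3"
  shows "norm v \<le> (1 + 1 / \<epsilon>) * norm (horizontal v)"
proof -
  have "\<epsilon> * \<bar>v $ 3\<bar> \<le> \<bar>n $ 3 * v $ 3\<bar>"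
    using assms(3,4) by (simp add: abs_mult mult_right_mono)
  also have "n $ 3 * v $ 3 = - (horizontal n \<bullet> horizontal v)"
    using assms(2) by (simp add: inner_eq_horizontal)
  also have "\<bar>\<dots>\<bar> \<le> norm (horizontal n) * norm (horizontal v)"
    using Cauchy_Schwarz_ineq2 by simp
  also have "\<dots> \<le> 1 * norm (horizontal v)"
    using norm_horizontal_le[of n] assms(1) by (intro mult_right_mono) auto
  finally have "\<bar>v $ 3\<bar> \<le> norm (horizontal v) / \<epsilon>"
    using \<open>\<epsilon> > 0\<close> by (simp add: field_simps)
  then show ?thesis
    using norm_le_horizontal[of v] by (simp add: algebra_simps)
qed

section \<open>Local behaviour of the projection in one chart\<close>

context
  fixes S U F N w \<epsilon>
  assumes par: "local_parametrization S U F" and gauss: "gauss_map S N" and wU: "w \<in> U"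
    and eps: "\<epsilon> > 0" "\<forall>p\<in>S. \<epsilon> \<le> N p $ 3"
begin

lemma tangent_le_horizontal:
  "norm (frechet_derivative F (at w) v) \<le> (1 + 1 / \<epsilon>) * norm (horizontal (frechet_derivative F (at w) v))"
  using local_parametrization_tangent[OF par gauss wU] eps
  by (intro norm_le_horizontal_of_transverse) auto

text \<open>By the slope bound the projected differential is injective, hence an isomorphism of the
  plane.\<close>

lemma horizontal_derivative_inverse:
  "\<exists>g. linear g \<and> (\<forall>u. g (horizontal (frechet_derivative F (at w) u)) = u) \<and>
     (\<forall>u. horizontal (frechet_derivative F (at w) (g u)) = u)"
proof -
  let ?L = "\<lambda>u. horizontal (frechet_derivative F (at w) u)"
  have linD: "linear (frechet_derivative F (at w))"
    using local_parametrization_smooth(3)[OF par wU] by (rule has_derivative_linear)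
  have "linear ?L"
    using linear_compose[OF linD linear_horizontal] by (simp add: o_def)
  moreover have "inj ?L"
  proof (subst linear_injective_0[OF \<open>linear ?L\<close>], intro allI impI)
    fix u assume "?L u = 0"
    then have "frechet_derivative F (at w) u = 0"
      using tangent_le_horizontal[of u] by simp
    then show "u = 0"
      using linear_injective_0[OF linD] local_parametrization_smooth(4)[OF par wU] by blast
  qed
  ultimately show ?thesis
    using linear_injective_isomorphism[of ?L] by blast
qed

text \<open>The constant depends on \<epsilon> alone and only the radius on the point; this
  uniformity is what the lifting argument needs.\<close>

lemma local_parametrization_expanding:
  "\<exists>r>0. \<forall>q\<in>S. dist q (F w) < r \<longrightarrow>
     dist q (F w) \<le> 2 * (1 + 1 / \<epsilon>) * dist (horizontal q) (horizontal (F w))"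
proof -
  obtain d where d: "d > 0" "\<And>y. norm (y - w) < d \<Longrightarrow>
      norm (F y - F w) \<le> 2 * (1 + 1 / \<epsilon>) * norm (horizontal (F y) - horizontal (F w))"
    using has_derivative_imp_projection_expanding[OF local_parametrization_smooth(3)[OF par wU] linear_horizontal
        norm_horizontal_le local_parametrization_smooth(4)[OF par wU] _ tangent_le_horizontal] eps(1)
    by (auto simp: add_pos_pos)
  obtain r where r: "r > 0" "S \<inter> ball (F w) r \<subseteq> F ` (U \<inter> ball w d)"
    using local_parametrization_nbhd[OF par wU, of "ball w d"] d(1) by auto
  have "dist q (F w) \<le> 2 * (1 + 1 / \<epsilon>) * dist (horizontal q) (horizontal (F w))"
    if q: "q \<in> S" "dist q (F w) < r" for q
  proof -
    have "q \<in> S \<inter> ball (F w) r" using q by (simp add: dist_commute)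
    then obtain y where "y \<in> ball w d" "q = F y" using r(2) by blast
    then show ?thesis
      using d(2)[of y] by (simp add: dist_norm norm_minus_commute)
  qed
  with r(1) show ?thesis by blast
qed

lemma local_parametrization_inj_horizontal:
  "\<exists>r>0. inj_on horizontal (S \<inter> ball (F w) r)"
proof -
  obtain g where g: "linear g" "\<And>u. g (horizontal (frechet_derivative F (at w) u)) = u"
    "\<And>u. horizontal (frechet_derivative F (at w) (g u)) = u"
    using horizontal_derivative_inverse by (elim exE conjE) simp
  obtain \<rho> where \<rho>: "\<rho> > 0" "ball w \<rho> \<subseteq> U" "inj_on (\<lambda>x. horizontal (F x)) (ball w \<rho>)"
  proof (rule has_derivative_locally_injective[of w U g
        "\<lambda>x u. horizontal (frechet_derivative F (at x) u)" "\<lambda>x. horizontal (F x)"])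
    show "bounded_linear g" using g(1) by (simp add: linear_conv_bounded_linear)
    show "g \<circ> (\<lambda>u. horizontal (frechet_derivative F (at w) u)) = id"
      by (simp add: fun_eq_iff g)
    show "((\<lambda>x. horizontal (F x)) has_derivative (\<lambda>u. horizontal (frechet_derivative F (at x) u))) (at x)"
      if "x \<in> U" for x
      by (rule bounded_linear.has_derivative[OF bounded_linear_horizontal local_parametrization_smooth(3)[OF par that]])
    fix e :: real assume "e > 0"
    \<comment> \<open>Half of \<open>e\<close>, since the operator norm must be strictly below
      \<open>e\<close>.\<close>
    then obtain d where d: "d > 0" "ball w d \<subseteq> U"
      "\<And>x v. x \<in> ball w d \<Longrightarrow> norm (frechet_derivative F (at x) v - frechet_derivative F (at w) v) \<le> e / 2 * norm v"
      using smooth_on_frechet_derivative_close[OF local_parametrization_smooth(1)[OF par] local_parametrization_smooth(2)[OF par] wU, of "e / 2"] by auto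
    have "onorm (\<lambda>v. horizontal (frechet_derivative F (at x) v) - horizontal (frechet_derivative F (at w) v)) < e"
      if "dist w x < d" for x
    proof -
      have "norm (horizontal (frechet_derivative F (at x) v) - horizontal (frechet_derivative F (at w) v))
          \<le> e / 2 * norm v" for v
        using order_trans[OF norm_horizontal_le d(3)[of x v]] that
        by (simp add: linear_diff[OF linear_horizontal])
      from onorm_le[OF this] show ?thesis using \<open>e > 0\<close> by simp
    qed
    with d(1) show "\<exists>d>0. \<forall>x. dist w x < d \<longrightarrow> onorm (\<lambda>v. horizontal (frechet_derivative F (at x) v) -
        horizontal (frechet_derivative F (at w) v)) < e" by blast
  qed (use wU local_parametrization_smooth(1)[OF par] in auto)
  obtain r where r: "r > 0" "S \<inter> ball (F w) r \<subseteq> F ` (U \<inter> ball w \<rho>)"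
    using local_parametrization_nbhd[OF par wU, of "ball w \<rho>"] \<rho>(1) by auto
  have "inj_on horizontal (F ` (U \<inter> ball w \<rho>))"
    using \<rho>(3) by (auto simp: inj_on_def)
  with r show ?thesis by (meson inj_on_subset)
qed

text \<open>The projected chart has an invertible derivative at \<open>w\<close>, so the open
  mapping theorem applies; over all points of \<open>W\<close> this makes the projection of
  \<open>W\<close> open.\<close>

lemma local_parametrization_interior_horizontal:
  assumes W: "openin (top_of_set S) W" "F w \<in> W"
  shows "horizontal (F w) \<in> interior (horizontal ` W)"
proof -
  have contF: "continuous_on U F" using local_parametrization_smooth(2)[OF par] by (rule smooth_on_continuous_on)
  obtain V where V: "open V" "W = S \<inter> V" using W(1) by (auto simp: openin_open)
  define T where "T = U \<inter> F -` V"
  have "open T"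
    unfolding T_def using contF local_parametrization_smooth(1)[OF par] V(1) by (intro continuous_open_preimage)
  obtain g where g: "linear g" "\<And>u. g (horizontal (frechet_derivative F (at w) u)) = u"
    "\<And>u. horizontal (frechet_derivative F (at w) (g u)) = u"
    using horizontal_derivative_inverse by (elim exE conjE) simp
  have "horizontal (F w) \<in> interior ((\<lambda>x. horizontal (F x)) ` T)"
  proof (rule sussmann_open_mapping[OF local_parametrization_smooth(1)[OF par] _ wU])
    show "continuous_on U (\<lambda>x. horizontal (F x))"
      by (rule linear_continuous_on_compose[OF contF linear_horizontal])
    show "((\<lambda>x. horizontal (F x)) has_derivative (\<lambda>u. horizontal (frechet_derivative F (at w) u))) (at w)"
      by (rule bounded_linear.has_derivative[OF bounded_linear_horizontal local_parametrization_smooth(3)[OF par wU]])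
    show "bounded_linear g" using g(1) by (simp add: linear_conv_bounded_linear)
    show "(\<lambda>u. horizontal (frechet_derivative F (at w) u)) \<circ> g = id"
      by (simp add: fun_eq_iff g)
    show "T \<subseteq> U" by (simp add: T_def)
    show "w \<in> interior T" using wU W V unfolding interior_open[OF \<open>open T\<close>] by (simp add: T_def)
  qed
  moreover have "(\<lambda>x. horizontal (F x)) ` T \<subseteq> horizontal ` W"
    using par V(2) by (auto simp: T_def local_parametrization_def)
  ultimately show ?thesis using interior_mono by blast
qed

end


section \<open>Comparison with a paraboloid at a local maximum\<close>

context
  fixes S U F N w \<epsilon> and \<sigma> \<delta> r :: real and y
  assumes par: "local_parametrization S U F" and gauss: "gauss_map S N" and wU: "w \<in> U"
    and eps: "\<epsilon> > 0" "\<forall>p\<in>S. \<epsilon> \<le> N p $ 3"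
    and "\<delta> \<ge> 0" and "r > 0"
    and max: "\<And>q. q \<in> S \<Longrightarrow> dist q (F w) < r \<Longrightarrow>
      \<sigma> * q $ 3 - \<delta> * (norm (horizontal q - y))\<^sup>2 \<le>
      \<sigma> * F w $ 3 - \<delta> * (norm (horizontal (F w) - y))\<^sup>2"
begin

text \<open>\<open>c\<close> is the Euclidean gradient at \<open>F w\<close> of the function
  maximised in \<open>max\<close>. The claims are the first and second order conditions along the
  line through \<open>w\<close> in direction \<open>v\<close>, with the Hessian of the paraboloid
  moved to the right.\<close>

lemma local_max_conditions:
  defines "c \<equiv> vector [- 2 * \<delta> * (horizontal (F w) - y) $ 1, - 2 * \<delta> * (horizontal (F w) - y) $ 2, \<sigma>]"
  shows "c \<bullet> frechet_derivative F (at w) v = 0"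
    and "c \<bullet> (\<Sum>i\<in>UNIV. \<Sum>j\<in>UNIV. (v $ i * v $ j) *\<^sub>R partial i (partial j F) w)
      \<le> 2 * \<delta> * (norm (horizontal (frechet_derivative F (at w) v)))\<^sup>2"
proof -
  have sm: "smooth_on U F" and opn: "open U" using par by (auto simp: local_parametrization_def)
  note contF = smooth_on_continuous_on[OF sm]
  define A where "A x = (\<Sum>j\<in>UNIV. v $ j *\<^sub>R partial j F x)" for x
  define B where "B = (\<Sum>i\<in>UNIV. \<Sum>j\<in>UNIV. (v $ i * v $ j) *\<^sub>R partial i (partial j F) w)"
  have A: "frechet_derivative F (at x) v = A x" if "x \<in> U" for x
    unfolding A_def using smooth_on_differentiable[OF sm that] by (rule has_derivative_partial)
  define T where "T = U \<inter> F -` ball (F w) r"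
  have "open T"
    unfolding T_def using contF opn by (intro continuous_open_preimage) auto
  moreover have "w \<in> T" using wU \<open>r > 0\<close> by (simp add: T_def)
  ultimately obtain e where e: "e > 0" "ball w e \<subseteq> T" using openE by blast
  \<comment> \<open>The summand 1 allows \<open>v = 0\<close>.\<close>
  define d where "d = e / (norm v + 1)"
  have "d > 0" using e(1) by (simp add: d_def add_nonneg_pos)
  have inT: "w + t *\<^sub>R v \<in> T" if "\<bar>t\<bar> < d" for t
  proof -
    have "\<bar>t\<bar> * norm v \<le> \<bar>t\<bar> * (norm v + 1)" by (simp add: mult_left_mono)
    also have "\<dots> < e" using that by (simp add: d_def pos_less_divide_eq add_nonneg_pos)
    finally show ?thesis using e(2) by (auto simp: dist_norm)
  qed
  define X where "X t = F (w + t *\<^sub>R v)" for t :: real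
  have X': "(X has_vector_derivative A (w + t *\<^sub>R v)) (at t)" if "\<bar>t\<bar> < d" for t
  proof -
    have "w + t *\<^sub>R v \<in> U" using inT[OF that] by (simp add: T_def)
    from has_vector_derivative_along_line[OF smooth_on_differentiable[OF sm this]] A[OF this]
    show ?thesis by (simp add: X_def[abs_def])
  qed
  have "(A has_derivative (\<lambda>u. \<Sum>j\<in>UNIV. v $ j *\<^sub>R frechet_derivative (partial j F) (at w) u)) (at w)"
    unfolding A_def
    by (intro has_derivative_sum has_derivative_scaleR_right smooth_on_differentiable[OF smooth_on_partial[OF sm] wU])
  then have "(A has_derivative (\<lambda>u. \<Sum>j\<in>UNIV. v $ j *\<^sub>R frechet_derivative (partial j F) (at w) u)) (at (w + 0 *\<^sub>R v))"
    by simp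
  from has_vector_derivative_along_line[OF this]
  have "((\<lambda>t. A (w + t *\<^sub>R v)) has_vector_derivative
      (\<Sum>j\<in>UNIV. v $ j *\<^sub>R frechet_derivative (partial j F) (at w) v)) (at 0)" .
  also have "(\<Sum>j\<in>UNIV. v $ j *\<^sub>R frechet_derivative (partial j F) (at w) v) = B"
    unfolding B_def
    by (subst sum.swap)
       (simp add: has_derivative_partial[OF smooth_on_differentiable[OF smooth_on_partial[OF sm] wU]]
        scaleR_sum_right mult.commute)
  finally have A': "((\<lambda>t. A (w + t *\<^sub>R v)) has_vector_derivative B) (at 0)" .
  define Y where "Y t = horizontal (X t) - y" for t
  have Y': "(Y has_vector_derivative horizontal (A (w + t *\<^sub>R v))) (at t)" if "\<bar>t\<bar> < d" for t
    unfolding Y_def using bounded_linear.has_vector_derivative[OF bounded_linear_horizontal X'[OF that]]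
    by (auto intro!: derivative_eq_intros)
  define h where "h t = \<sigma> * (X t \<bullet> e3) - \<delta> * (Y t \<bullet> Y t)" for t
  define h' where "h' t = \<sigma> * (A (w + t *\<^sub>R v) \<bullet> e3) - 2 * \<delta> * (Y t \<bullet> horizontal (A (w + t *\<^sub>R v)))" for t
  have d1: "(h has_real_derivative h' t) (at t)" if t: "\<bar>t\<bar> < d" for t
    unfolding h_def h'_def
    by (rule derivative_eq_intros has_real_derivative_inner[OF X'[OF t] has_vector_derivative_const]
          has_real_derivative_inner[OF Y'[OF t] Y'[OF t]] refl)+
       (simp add: inner_commute)
  have Y0: "(Y has_vector_derivative horizontal (A w)) (at 0)" using Y'[of 0] \<open>d > 0\<close> by simp
  have d2: "(h' has_real_derivative (c \<bullet> B - 2 * \<delta> * (norm (horizontal (A w)))\<^sup>2)) (at 0)"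
    unfolding h'_def
    by (rule derivative_eq_intros has_real_derivative_inner[OF A' has_vector_derivative_const]
          has_real_derivative_inner[OF Y0 bounded_linear.has_vector_derivative[OF bounded_linear_horizontal A']] refl)+
       (simp add: c_def inner_e3 power2_norm_eq_inner Y_def X_def horizontal_def
          inner_vec_def sum_2 sum_3 axis_def algebra_simps)
  have d3: "h t \<le> h 0" if "\<bar>t\<bar> < d" for t
  proof -
    have "X t \<in> S" "dist (X t) (F w) < r"
      using inT[OF that] par by (auto simp: T_def X_def local_parametrization_def dist_commute)
    from max[OF this] show ?thesis
      by (simp add: h_def Y_def inner_e3 power2_norm_eq_inner X_def)
  qed
  have "h' 0 = c \<bullet> A w"
    by (simp add: h'_def c_def inner_e3 Y_def X_def horizontal_def inner_vec_def sum_2 sum_3 axis_def algebra_simps)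
  then show "c \<bullet> frechet_derivative F (at w) v = 0"
    using local_max_second_derivative(1)[OF \<open>d > 0\<close> d1 d2 d3] by (simp add: A[OF wU])
  show "c \<bullet> (\<Sum>i\<in>UNIV. \<Sum>j\<in>UNIV. (v $ i * v $ j) *\<^sub>R partial i (partial j F) w)
      \<le> 2 * \<delta> * (norm (horizontal (frechet_derivative F (at w) v)))\<^sup>2"
    using local_max_second_derivative(2)[OF \<open>d > 0\<close> d1 d2 d3] by (simp add: A[OF wU] flip: B_def)
qed

text \<open>The gradient is orthogonal to the tangent plane, hence a multiple of the normal; third
  components give the factor.\<close>

lemma local_max_hessian:
  "\<sigma> / N (F w) $ 3 * (N (F w) \<bullet> (\<Sum>i\<in>UNIV. \<Sum>j\<in>UNIV. (v $ i * v $ j) *\<^sub>R partial i (partial j F) w))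
    \<le> 2 * \<delta> * (norm (frechet_derivative F (at w) v))\<^sup>2"
proof -
  define c :: "real^3" where
    "c = vector [- 2 * \<delta> * (horizontal (F w) - y) $ 1, - 2 * \<delta> * (horizontal (F w) - y) $ 2, \<sigma>]"
  let ?D = "frechet_derivative F (at w)" and ?n = "N (F w)"
  have n3: "?n $ 3 > 0"
    using eps(1) bspec[OF eps(2) local_parametrization_tangent(1)[OF par gauss wU]] by linarith
  obtain g where "linear g" "\<And>u. g (horizontal (?D u)) = u" and g: "\<And>u. horizontal (?D (g u)) = u"
    using horizontal_derivative_inverse[OF par gauss wU eps] by (elim exE conjE) simp
  \<comment> \<open>Subtracting the tangent vector \<open>a\<close> with the same horizontal part
    leaves a vertical vector, on which \<open>c\<close> and the normal are compared
    directly.\<close>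
  have "c \<bullet> Y = \<sigma> / ?n $ 3 * (?n \<bullet> Y)" for Y
  proof -
    define a where "a = ?D (g (horizontal Y))"
    have "horizontal (Y - a) = 0"
      by (simp add: a_def g linear_diff[OF linear_horizontal])
    then have "c \<bullet> (Y - a) = \<sigma> * (Y - a) $ 3" "?n \<bullet> (Y - a) = ?n $ 3 * (Y - a) $ 3"
      by (simp_all add: inner_eq_horizontal c_def)
    moreover have "c \<bullet> a = 0" "?n \<bullet> a = 0"
      using local_max_conditions(1) local_parametrization_tangent(3)[OF par gauss wU]
      by (auto simp: a_def c_def)
    ultimately show ?thesis using n3 by (simp add: inner_diff_right)
  qed
  \<comment> \<open>Passing to the full norm makes the right side a multiple of the first
    fundamental form.\<close>
  moreover have "2 * \<delta> * (norm (horizontal (?D v)))\<^sup>2 \<le> 2 * \<delta> * (norm (?D v))\<^sup>2"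
    using \<open>\<delta> \<ge> 0\<close> norm_horizontal_le by (intro mult_left_mono power_mono) auto
  ultimately show ?thesis
    using local_max_conditions(2)[of v, folded c_def] by fastforce
qed

text \<open>The metric trace of the Hessian inequality contains the normal component of the mean
  curvature vector, which is \<phi>' times \<open>N (F w) $ 3\<close>; the factor
  \<open>\<sigma> / N (F w) $ 3\<close> cancels the slope.\<close>

lemma phi_minimal_local_max:
  assumes "phi_minimal \<phi> S N"
  shows "\<sigma> * deriv \<phi> (F w $ 3) \<le> 4 * \<delta>"
proof -
  let ?n = "N (F w)" and ?D = "frechet_derivative F (at w)"
  let ?P = "\<lambda>i j. partial i (partial j F) w"
  define G where "G = first_fundamental_form F w"
  have der: "(F has_derivative ?D) (at w)"
    using par wU by (auto simp: local_parametrization_def intro: smooth_on_differentiable)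
  note D = has_derivative_partial[OF der]
  have "inj ?D" using par wU by (auto simp: local_parametrization_def)
  then have D0: "?D v \<noteq> 0" if "v \<noteq> 0" for v
    using linear_injective_0[OF has_derivative_linear[OF der]] that by blast
  have norm1: "norm ?n = 1" and n3: "?n $ 3 > 0"
    using eps(1) bspec[OF eps(2) local_parametrization_tangent(1)[OF par gauss wU]]
      local_parametrization_tangent(2)[OF par gauss wU] by auto
  have Gsym: "G $ 2 $ 1 = G $ 1 $ 2"
    by (simp add: G_def first_fundamental_form_def inner_commute)
  have normD: "(norm (?D v))\<^sup>2 = (v$1)\<^sup>2 * G$1$1 + v$1 * v$2 * (G$1$2 + G$2$1) + (v$2)\<^sup>2 * G$2$2" for v
    unfolding power2_norm_eq_inner
    by (simp add: D sum_2 G_def first_fundamental_form_def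
        inner_add_left inner_add_right algebra_simps power2_eq_square)
  have vec_ne: "(vector [x1, x2] :: real^2) \<noteq> 0" if "x1 \<noteq> 0 \<or> x2 \<noteq> 0" for x1 x2
    using that by (auto simp: vec_eq_iff forall_2)
  have G11: "G $ 1 $ 1 > 0"
    using D0[OF vec_ne[of 1 0]] normD[of "vector [1, 0]"] zero_less_power[of "norm (?D (vector [1, 0]))" 2]
    by simp
  \<comment> \<open>Positivity of the determinant is read off from the length of a tangent vector
    orthogonal to the first coordinate field.\<close>
  have "(norm (?D (vector [- G$1$2, G$1$1])))\<^sup>2 = G $ 1 $ 1 * det G"
    by (simp only: normD) (simp add: det_2 Gsym algebra_simps power2_eq_square)
  then have "G $ 1 $ 1 * det G > 0"
    using D0[OF vec_ne[of "- G$1$2" "G$1$1"]] G11 by (metis less_irrefl zero_less_norm_iff zero_less_power)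
  then have detG: "det G > 0" using G11 by (simp add: zero_less_mult_iff)
  have "(\<Sum>i\<in>UNIV. \<Sum>j\<in>UNIV. matrix_inv G $ i $ j * (\<sigma> / ?n $ 3 * (?n \<bullet> ?P i j) - 2 * \<delta> * G $ i $ j)) \<le> 0"
  proof (rule trace_matrix_inv_nonpos[OF Gsym G11 detG])
    fix x1 x2 :: real
    show "x1\<^sup>2 * (\<sigma> / ?n $ 3 * (?n \<bullet> ?P 1 1) - 2 * \<delta> * G $ 1 $ 1) +
        x1 * x2 * (\<sigma> / ?n $ 3 * (?n \<bullet> ?P 1 2) - 2 * \<delta> * G $ 1 $ 2 +
                  (\<sigma> / ?n $ 3 * (?n \<bullet> ?P 2 1) - 2 * \<delta> * G $ 2 $ 1)) +
        x2\<^sup>2 * (\<sigma> / ?n $ 3 * (?n \<bullet> ?P 2 2) - 2 * \<delta> * G $ 2 $ 2) \<le> 0"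
      using local_max_hessian[of "vector [x1, x2]"] unfolding normD
      by (simp add: sum_2 inner_add_right algebra_simps power2_eq_square)
  qed
  also have "(\<Sum>i\<in>UNIV. \<Sum>j\<in>UNIV. matrix_inv G $ i $ j * (\<sigma> / ?n $ 3 * (?n \<bullet> ?P i j) - 2 * \<delta> * G $ i $ j)) =
     \<sigma> / ?n $ 3 * (\<Sum>i\<in>UNIV. \<Sum>j\<in>UNIV. matrix_inv G $ i $ j * (?n \<bullet> ?P i j)) -
     2 * \<delta> * (\<Sum>i\<in>UNIV. \<Sum>j\<in>UNIV. matrix_inv G $ i $ j * G $ i $ j)"
    by (simp add: sum_2 algebra_simps)
  also have "(\<Sum>i\<in>UNIV. \<Sum>j\<in>UNIV. matrix_inv G $ i $ j * (?n \<bullet> ?P i j)) = mean_curvature_vector N F w \<bullet> ?n"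
    using norm1 by (simp add: mean_curvature_vector_def second_fundamental_form_def normal_part_def
        inner_sum_left inner_sum_right inner_commute norm_eq_1 flip: G_def)
  also have "mean_curvature_vector N F w = deriv \<phi> (F w \<bullet> e3) *\<^sub>R normal_part ?n e3"
    using assms par wU by (auto simp: phi_minimal_def)
  also have "\<dots> \<bullet> ?n = deriv \<phi> (F w $ 3) * ?n $ 3"
    using norm1 by (simp add: normal_part_def norm_eq_1 inner_e3 inner_commute[of e3])
  finally show ?thesis
    using n3 by (simp add: trace_matrix_inv_self[OF Gsym detG])
qed

end

section \<open>Nonexistence of the surface\<close>

theorem theoremC:
  fixes a b :: ereal and \<phi> :: "real \<Rightarrow> real"
  assumes "a < b"
    and "smooth_on (einterval a b) \<phi>"
    and "mono_on (einterval a b) \<phi> \<or> antimono_on (einterval a b) \<phi>"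
    and "\<forall>t\<in>einterval a b. deriv (deriv \<phi>) t \<ge> 0"
  shows "\<not> (\<exists>(S :: (real^3) set) N.
            properly_embedded_surface S \<and> S \<subseteq> slab a b \<and> gauss_map S N \<and>
            phi_minimal \<phi> S N \<and>
            (\<exists>C>0. \<exists>R. \<forall>p\<in>S. norm p \<ge> R \<longrightarrow> \<bar>deriv \<phi> (p \<bullet> e3)\<bar> \<le> C * norm p) \<and>
            (\<exists>\<epsilon>>0. \<forall>p\<in>S. N p \<bullet> e3 \<ge> \<epsilon>) \<and>
            ((INF p\<in>S. (deriv \<phi> (p \<bullet> e3))\<^sup>2) > 0 \<or>
             (INF p\<in>S. deriv (deriv \<phi>) (p \<bullet> e3)) > 0))"
proof (intro notI, elim exE conjE)
  fix S :: "(real^3) set" and N \<epsilon>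
  assume S: "properly_embedded_surface S" and Sslab: "S \<subseteq> slab a b" and gauss: "gauss_map S N"
    and min: "phi_minimal \<phi> S N"
    and eps: "0 < \<epsilon>" "\<forall>p\<in>S. N p \<bullet> e3 \<ge> \<epsilon>"
    and inf: "(INF p\<in>S. (deriv \<phi> (p \<bullet> e3))\<^sup>2) > 0 \<or> (INF p\<in>S. deriv (deriv \<phi>) (p \<bullet> e3)) > 0"
  let ?I = "einterval a b"
  have zI: "p $ 3 \<in> ?I" if "p \<in> S" for p
    using Sslab that by (auto simp: slab_def inner_e3)
  have N3: "\<forall>p\<in>S. \<epsilon> \<le> N p $ 3"
    using eps by (simp add: inner_e3)
  have param: "\<exists>U F w. local_parametrization S U F \<and> w \<in> U \<and> F w = p" if "p \<in> S" for p
    using S that by (force simp: properly_embedded_surface_def embedded_surface_def)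
  have "closed_map (top_of_set S) euclidean (\<lambda>p. p)"
    using S proper_imp_closed_map by (auto simp: properly_embedded_surface_def)
  moreover have "closedin (top_of_set S) S" by simp
  ultimately have "closedin euclidean ((\<lambda>p. p) ` S)"
    unfolding closed_map_def by blast
  then have "closed S" by simp
  obtain p where p: "p \<in> S" using S by (auto simp: properly_embedded_surface_def embedded_surface_def)
  note \<phi>' = smooth_on_deriv[OF open_einterval assms(2)]
  have \<phi>'_mono: "deriv \<phi> s \<le> deriv \<phi> t" if st: "s \<in> ?I" "t \<in> ?I" "s \<le> t" for s t
  proof (rule DERIV_nonneg_imp_nondecreasing[OF \<open>s \<le> t\<close>])
    fix x assume "s \<le> x" "x \<le> t"
    then have "x \<in> ?I"
      using st unfolding einterval_iff by (meson ereal_less_eq(3) less_le_trans le_less_trans)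
    then show "\<exists>y. (deriv \<phi> has_real_derivative y) (at x) \<and> 0 \<le> y"
      using \<phi>'(2) assms(4) by blast
  qed
  have \<phi>'_nz: "deriv \<phi> (p $ 3) \<noteq> 0"
  proof
    assume zero: "deriv \<phi> (p $ 3) = 0"
    \<comment> \<open>A real infimum bounds the values only if the set is bounded below; 0 serves
      here and, by convexity, for the second derivative.\<close>
    have "bdd_below ((\<lambda>p. (deriv \<phi> (p \<bullet> e3))\<^sup>2) ` S)"
      by (rule bdd_belowI2[where m = 0]) simp
    from cINF_lower[OF this p] have "\<not> (INF p\<in>S. (deriv \<phi> (p \<bullet> e3))\<^sup>2) > 0"
      using zero by (simp add: inner_e3)
    then have "(INF p\<in>S. deriv (deriv \<phi>) (p \<bullet> e3)) > 0" using inf by blast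
    moreover have "bdd_below ((\<lambda>p. deriv (deriv \<phi>) (p \<bullet> e3)) ` S)"
      using zI assms(4) by (intro bdd_belowI2[where m = 0]) (simp add: inner_e3)
    ultimately have pos: "deriv (deriv \<phi>) (p $ 3) > 0"
      using cINF_lower[OF _ p] by (fastforce simp: inner_e3)
    obtain r where r: "r > 0" "\<And>t. \<bar>t - p $ 3\<bar> < r \<Longrightarrow> t \<in> ?I"
      using open_einterval zI[OF p] unfolding open_dist dist_real_def by blast
    note der = \<phi>'(2)[OF zI[OF p]]
    obtain e1 where e1: "e1 > 0" "\<And>h. 0 < h \<Longrightarrow> h < e1 \<Longrightarrow> 0 < deriv \<phi> (p $ 3 + h)"
      using DERIV_pos_inc_right[OF der pos] zero by auto
    obtain e2 where e2: "e2 > 0" "\<And>h. 0 < h \<Longrightarrow> h < e2 \<Longrightarrow> deriv \<phi> (p $ 3 - h) < 0"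
      using DERIV_pos_inc_left[OF der pos] zero by auto
    \<comment> \<open>Halving keeps \<open>h\<close> strictly inside all three radii.\<close>
    define h where "h = min r (min e1 e2) / 2"
    have h: "0 < h" "h < r" "h < e1" "h < e2" using r e1 e2 by (auto simp: h_def)
    have hI: "t \<in> ?I" if "\<bar>t - p $ 3\<bar> \<le> h" for t using r(2) h that by auto
    have \<phi>h: "(\<phi> has_real_derivative deriv \<phi> t) (at t)" if "\<bar>t - p $ 3\<bar> \<le> h" for t
      using \<phi>'(1) hI[OF that] .
    have "\<phi> (p $ 3) < \<phi> (p $ 3 + h)"
    proof (rule DERIV_pos_imp_increasing_open[of "p $ 3" "p $ 3 + h" \<phi>])
      show "p $ 3 < p $ 3 + h" using h by simp
      show "\<exists>y. (\<phi> has_real_derivative y) (at x) \<and> 0 < y" if "p $ 3 < x" "x < p $ 3 + h" for x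
        using \<phi>h[of x] e1(2)[of "x - p $ 3"] h that by auto
      show "continuous_on {p $ 3..p $ 3 + h} \<phi>"
        by (rule DERIV_atLeastAtMost_imp_continuous_on, rule exI, rule \<phi>h) auto
    qed
    moreover have "\<phi> (p $ 3) < \<phi> (p $ 3 - h)"
    proof (rule DERIV_neg_imp_decreasing_open[of "p $ 3 - h" "p $ 3" \<phi>])
      show "p $ 3 - h < p $ 3" using h by simp
      show "\<exists>y. (\<phi> has_real_derivative y) (at x) \<and> y < 0" if "p $ 3 - h < x" "x < p $ 3" for x
        using \<phi>h[of x] e2(2)[of "p $ 3 - x"] h that by auto
      show "continuous_on {p $ 3 - h..p $ 3} \<phi>"
        by (rule DERIV_atLeastAtMost_imp_continuous_on, rule exI, rule \<phi>h) auto
    qed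
    \<comment> \<open>Strictly larger values on both sides exclude both kinds of
      monotonicity.\<close>
    ultimately show False
      using assms(3) hI[of "p $ 3"] hI[of "p $ 3 + h"] hI[of "p $ 3 - h"] h
      unfolding monotone_on_def by fastforce
  qed
  define M where "M = 2 * (1 + 1 / \<epsilon>)"
  have "M > 0" using eps(1) by (simp add: M_def add_pos_pos)
  have conthor: "continuous_on X horizontal" for X
    using bounded_linear_horizontal by (rule linear_continuous_on)
  obtain A where A: "closed A" "openin (top_of_set S) A" "p \<in> A"
    "\<And>q. q \<in> A \<Longrightarrow> dist q p \<le> M * dist (horizontal q) (horizontal p)"
  proof (rule clopen_sheet[OF \<open>closed S\<close> conthor less_imp_le[OF \<open>M > 0\<close>] p])
    show "\<exists>r>0. \<forall>q\<in>S. dist q x < r \<longrightarrow> dist q x \<le> M * dist (horizontal q) (horizontal x)" if "x \<in> S" for x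
      using param[OF that] local_parametrization_expanding[OF _ gauss _ eps(1) N3] unfolding M_def by metis
    show "\<exists>r>0. inj_on horizontal (S \<inter> ball x r)" if "x \<in> S" for x
      using param[OF that] local_parametrization_inj_horizontal[OF _ gauss _ eps(1) N3] by metis
    show "open (horizontal ` W)" if W: "openin (top_of_set S) W" for W
    proof -
      have "horizontal x \<in> interior (horizontal ` W)" if "x \<in> W" for x
        using param[of x] local_parametrization_interior_horizontal[OF _ gauss _ eps(1) N3 W] that
          openin_imp_subset[OF W] by (metis subsetD)
      then show ?thesis by (metis image_subsetI interior_subset open_interior subset_antisym)
    qed
  qed blast
  have AS: "A \<subseteq> S" using A(2) by (rule openin_imp_subset)
  define \<sigma> :: real where "\<sigma> = sgn (deriv \<phi> (p $ 3))"
  \<comment> \<open>With this value \<open>4 * \<delta>\<close> is half of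
    \<open>\<bar>deriv \<phi> (p $ 3)\<bar>\<close>.\<close>
  define \<delta> where "\<delta> = \<bar>deriv \<phi> (p $ 3)\<bar> / 8"
  have "\<delta> > 0" using \<phi>'_nz by (simp add: \<delta>_def)
  define f where "f q = \<sigma> * q $ 3 - \<delta> * (norm (horizontal q - horizontal p))\<^sup>2" for q
  have contf: "continuous_on X f" for X
    unfolding f_def by (intro continuous_intros conthor)
  \<comment> \<open>This superlevel set is compact: on \<open>A\<close> the height gain is at most
    \<open>M * s\<close>, which the penalty \<open>\<delta> * s\<^sup>2\<close> exceeds for large
    \<open>s\<close>.\<close>
  define K where "K = {q \<in> A. f p \<le> f q}"
  have "bounded K"
  proof (rule bounded_subset[OF bounded_cball], rule subsetI)
    fix q assume q: "q \<in> K"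
    define s where "s = norm (horizontal q - horizontal p)"
    have d: "dist q p \<le> M * s" using A(4)[of q] q by (simp add: K_def s_def dist_norm)
    have "\<delta> * s\<^sup>2 \<le> \<sigma> * (q $ 3 - p $ 3)"
      using q by (simp add: K_def f_def s_def algebra_simps)
    also have "\<dots> \<le> \<bar>q $ 3 - p $ 3\<bar>" by (auto simp: \<sigma>_def sgn_if abs_if)
    also have "\<dots> \<le> dist q p"
      using component_le_norm_cart[of "q - p" 3] by (simp add: dist_norm)
    also note d
    finally have "s * (\<delta> * s) \<le> s * M" by (simp add: power2_eq_square ac_simps)
    then have "s \<le> M / \<delta>"
      using \<open>\<delta> > 0\<close> \<open>M > 0\<close> by (cases "s = 0") (auto simp: s_def field_simps)
    with d \<open>M > 0\<close> have "dist q p \<le> M * (M / \<delta>)"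
      by (meson less_imp_le mult_left_mono order_trans)
    then show "q \<in> cball p (M * (M / \<delta>))" by (simp add: dist_commute)
  qed
  moreover have "closed K"
    unfolding K_def using A(1) contf by (intro continuous_on_closed_Collect_le continuous_on_const)
  ultimately have "compact K" by (simp add: compact_eq_bounded_closed)
  moreover have "p \<in> K" using A(3) by (simp add: K_def)
  ultimately obtain q where q: "q \<in> K" "\<And>x. x \<in> K \<Longrightarrow> f x \<le> f q"
    using continuous_attains_sup[OF _ _ contf, of K] by blast
  have qA: "q \<in> A" "q \<in> S" using q(1) AS by (auto simp: K_def)
  \<comment> \<open>Outside \<open>K\<close> the values lie below \<open>f p\<close>, and
    \<open>p\<close> belongs to \<open>K\<close>.\<close>
  have qmax: "f x \<le> f q" if "x \<in> A" for x
    using q that by (cases "f p \<le> f x") (auto simp: K_def)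
  \<comment> \<open>As \<open>A\<close> is open in \<open>S\<close>, the maximum over
    \<open>A\<close> is a local maximum on \<open>S\<close>.\<close>
  obtain r where r: "r > 0" "ball q r \<inter> S \<subseteq> A"
    using A(2) qA(1) unfolding openin_contains_ball by blast
  obtain U F w where F: "local_parametrization S U F" "w \<in> U" "F w = q"
    using param[OF qA(2)] by blast
  have "\<sigma> * deriv \<phi> (F w $ 3) \<le> 4 * \<delta>"
  proof (rule phi_minimal_local_max[OF F(1) gauss F(2) eps(1) N3 _ r(1) _ min])
    show "0 \<le> \<delta>" using \<open>\<delta> > 0\<close> by simp
    fix x assume "x \<in> S" "dist x (F w) < r"
    then have "x \<in> A" using r(2) by (auto simp: F(3) dist_commute)
    from qmax[OF this]
    show "\<sigma> * x $ 3 - \<delta> * (norm (horizontal x - horizontal p))\<^sup>2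
        \<le> \<sigma> * F w $ 3 - \<delta> * (norm (horizontal (F w) - horizontal p))\<^sup>2"
      by (simp add: f_def F(3))
  qed
  moreover have "\<sigma> * p $ 3 \<le> \<sigma> * q $ 3"
  proof -
    have "0 \<le> \<delta> * (norm (horizontal q - horizontal p))\<^sup>2" using \<open>\<delta> > 0\<close> by simp
    then show ?thesis using qmax[OF A(3)] by (simp add: f_def)
  qed
  \<comment> \<open>For either sign, moving from \<open>p\<close> to \<open>q\<close> changes the
    height in the direction in which \<open>\<sigma> * deriv \<phi>\<close> does not
    decrease.\<close>
  then have "\<bar>deriv \<phi> (p $ 3)\<bar> \<le> \<sigma> * deriv \<phi> (q $ 3)"
    using \<phi>'_mono[of "p $ 3" "q $ 3"] \<phi>'_mono[of "q $ 3" "p $ 3"] zI p qA(2) \<phi>'_nz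
    by (auto simp: \<sigma>_def sgn_if split: if_splits)
  ultimately show False using \<open>\<delta> > 0\<close> by (simp add: F(3) \<delta>_def)
qed

end
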